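(* Let $s\ge 2$, let $\pi$ be a probability vector on $\{1,\dots,s\}$ and let $M$ be a symmetric $s\times s$ matrix with non-negative entries such that $d:=\sum_j M_{ij}\pi_j>0$ does not depend on $i$. Let $\mathbb{P}_n$ be the stochastic block model with parameters $(n,M,\pi)$, and let $A=M-d\mathbf{1}\mathbf{1}^T$, where $\mathbf 1$ is the all-ones vector. If $Q(\pi,A/\sqrt{2d})<1$, then $\mathbb{P}_n$ is not reconstructable.
   Context: Stochastic block model $(n,M,\pi)$: each vertex $v\in\{1,\dots,n\}$ receives an independent label $\sigma_v\in\{1,\dots,s\}$ with distribution $\pi$; conditionally on the labels, each edge $\{u,v\}$ is included independently with probability $M_{\sigma_u,\sigma_v}/n$ ($n$ large). $\mathbb{P}_n$ is the joint law of $(G,\sigma)$; $M,\pi$ are fixed as $n\to\infty$. Definition of $Q$: let $\Delta_{s^2}(\pi)$ be the set of probability vectors $\alpha=(\alpha_{ij})_{i,j=1}^s$ with both marginals equal to $\pi$: $\alpha_{ij}\ge0$, $\sum_i\alpha_{ij}=\pi_j$ for all $j$, $\sum_j\alpha_{ij}=\pi_i$ for all $i$. Let $p=\pi\otimes\pi$, i.e. $p_{ij}=\pi_i\pi_j$, and $D(\alpha,p)=\sum_{ij}\alpha_{ij}\log(\alpha_{ij}/p_{ij})$ (Kullback–Leibler divergence, with terms with $\alpha_{ij}=0$ equal to $0$). For an $s\times s$ matrix $B$, $$Q(\pi,B)=\sup_{\alpha\in\Delta_{s^2}(\pi),\ \alpha\ne p}\frac{(\alpha-p)^T(B\otimes B)(\alpha-p)}{D(\alpha,p)},$$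 where $(B\otimes B)_{(ij),(k\ell)}=B_{ik}B_{j\ell}$. Overlap: for labellings $\sigma,\tau\in\{1,\dots,s\}^n$ let $N_i(\sigma)=\#\{v:\sigma_v=i\}$, $N_{ij}(\sigma,\tau)=\#\{v:\sigma_v=i,\tau_v=j\}$ and $$\mathrm{overlap}(\sigma,\tau)=\frac1n\max_\rho\sum_{i=1}^s\Big(N_{i\rho(i)}(\sigma,\tau)-\frac1nN_i(\sigma)N_{\rho(i)}(\tau)\Big),$$ the maximum being over all permutations $\rho$ of $\{1,\dots,s\}$. Reconstructable: there are $\delta>0$ and an algorithm $\mathcal{A}$ (a map from graphs to labellings) such that, for $(G,\sigma)\sim\mathbb{P}_n$, $\lim_{n\to\infty}\Pr(\mathrm{overlap}(\mathcal{A}(G),\sigma)>\delta)>0$. *)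

theory Defs
  imports "HOL-Probability.Probability"
begin

section \<open>The functional Q\<close>

text \<open>
  The label set \<open>{1,\<dots>,s}\<close> is an arbitrary finite type \<open>'s\<close>, so that \<open>s = CARD('s)\<close>, and
  \<open>\<pi>\<close> is a pmf on it, \<open>\<pi>\<^sub>i = pmf \<pi> i\<close>; zero entries are allowed.
\<close>

definition couplings :: "'s::finite pmf \<Rightarrow> (real ^ ('s \<times> 's)) set" where
  "couplings \<pi> = {\<alpha>. (\<forall>i j. 0 \<le> \<alpha> $ (i, j))
      \<and> (\<forall>j. (\<Sum>i\<in>UNIV. \<alpha> $ (i, j)) = pmf \<pi> j)
      \<and> (\<forall>i. (\<Sum>j\<in>UNIV. \<alpha> $ (i, j)) = pmf \<pi> i)}"

definition product_coupling :: "'s::finite pmf \<Rightarrow> real ^ ('s \<times> 's)" where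
  "product_coupling \<pi> = (\<chi> ij. pmf \<pi> (fst ij) * pmf \<pi> (snd ij))"

text \<open>
  Terms with \<open>\<alpha>\<^sub>k = 0\<close> vanish because of the leading factor. The case \<open>\<alpha>\<^sub>k > 0 = p\<^sub>k\<close>, where the
  divergence would be infinite, does not occur for \<open>\<alpha> \<in> couplings \<pi>\<close> and
  \<open>p = product_coupling \<pi>\<close>.
\<close>

definition KL_div :: "real ^ 'k::finite \<Rightarrow> real ^ 'k \<Rightarrow> real" where
  "KL_div \<alpha> p = (\<Sum>k\<in>UNIV. \<alpha> $ k * ln (\<alpha> $ k / p $ k))"

definition kronecker :: "real ^ 's ^ 's \<Rightarrow> real ^ 's ^ 's \<Rightarrow> real ^ ('s \<times> 's) ^ ('s::finite \<times> 's)" where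
  "kronecker A B = (\<chi> ij kl. A $ fst ij $ fst kl * B $ snd ij $ snd kl)"

text \<open>
  Extended reals make the supremum unconditionally meaningful; it is \<open>-\<infinity>\<close> when
  \<open>product_coupling \<pi>\<close> is the only coupling, i.e. when \<open>\<pi>\<close> is a point mass.
\<close>

definition Q :: "'s::finite pmf \<Rightarrow> real ^ 's ^ 's \<Rightarrow> ereal" where
  "Q \<pi> B = (let p = product_coupling \<pi> in
     SUP \<alpha> \<in> couplings \<pi> - {p}.
       ereal (((\<alpha> - p) \<bullet> (kronecker B B *v (\<alpha> - p))) / KL_div \<alpha> p))"

section \<open>The stochastic block model\<close>

text \<open>
  A graph is a pair of a vertex set and a set of two-element edges. A labelling is a total function
  on \<^typ>\<open>nat\<close> of which only the values on the vertices matter.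
\<close>

type_synonym graph = "nat set \<times> nat set set"
type_synonym 's labelling = "nat \<Rightarrow> 's"

text \<open>
  \<open>min 1\<close> only matters for the finitely many \<open>n\<close> below the largest entry of \<open>M\<close>, for which
  \<open>M $ i $ j / n\<close> need not be a probability.
  Each unordered pair of vertices is represented once, with the smaller vertex first; the order is
  immaterial for symmetric \<open>M\<close>.
\<close>

definition sbm_graph :: "nat \<Rightarrow> real ^ 's ^ 's \<Rightarrow> 's::finite labelling \<Rightarrow> graph pmf" where
  "sbm_graph n M \<sigma> =
     map_pmf (\<lambda>X. ({1..n}, {{u, v} | u v. X (u, v)}))
       (Pi_pmf {(u, v). 1 \<le> u \<and> u < v \<and> v \<le> n} False
         (\<lambda>(u, v). bernoulli_pmf (min 1 (M $ \<sigma> u $ \<sigma> v / real n))))"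

definition sbm :: "nat \<Rightarrow> real ^ 's ^ 's \<Rightarrow> 's::finite pmf \<Rightarrow> (graph \<times> 's labelling) pmf" where
  "sbm n M \<pi> = do {
     \<sigma> \<leftarrow> Pi_pmf {1..n} undefined (\<lambda>_. \<pi>);
     G \<leftarrow> sbm_graph n M \<sigma>;
     return_pmf (G, \<sigma>)
   }"

section \<open>Overlap and reconstruction\<close>

definition label_count :: "nat \<Rightarrow> 's labelling \<Rightarrow> 's \<Rightarrow> nat" where
  "label_count n \<sigma> i = card {v \<in> {1..n}. \<sigma> v = i}"

definition joint_label_count ::
    "nat \<Rightarrow> 's labelling \<Rightarrow> 's labelling \<Rightarrow> 's \<Rightarrow> 's \<Rightarrow> nat" where
  "joint_label_count n \<sigma> \<tau> i j = card {v \<in> {1..n}. \<sigma> v = i \<and> \<tau> v = j}"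

definition overlap :: "nat \<Rightarrow> 's::finite labelling \<Rightarrow> 's labelling \<Rightarrow> real" where
  "overlap n \<sigma> \<tau> = 1 / real n *
     Max ((\<lambda>\<rho>. \<Sum>i\<in>UNIV. real (joint_label_count n \<sigma> \<tau> i (\<rho> i))
                - 1 / real n * real (label_count n \<sigma> i) * real (label_count n \<tau> (\<rho> i)))
          ` {\<rho>. \<rho> permutes UNIV})"

text \<open>An algorithm is an arbitrary deterministic map from graphs to labellings.\<close>

definition reconstructable :: "real ^ 's ^ 's \<Rightarrow> 's::finite pmf \<Rightarrow> bool" where
  "reconstructable M \<pi> \<longleftrightarrow>
     (\<exists>\<delta>>0. \<exists>\<A> :: graph \<Rightarrow> 's labelling. \<exists>L>0.
       (\<lambda>n. measure_pmf.prob (sbm n M \<pi>) {(G, \<sigma>). overlap n (\<A> G) \<sigma> > \<delta>}) \<longlonglongrightarrow> L)"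

end

theory Submission
  imports Defs "HOL-Real_Asymp.Real_Asymp"
begin

text \<open>
  Let \<open>R\<close> be the law of the Erdos--Renyi graph with edge probability \<open>d / n\<close>, \<open>\<sigma>\<close> and \<open>\<tau>\<close> two
  independent labellings, and \<open>\<alpha>\<close> their empirical joint distribution. A large overlap forces, for
  some labels \<open>i, j\<close>, the average over \<open>v\<close> of \<open>[\<A>(G)\<^sub>v = i] ([\<sigma>\<^sub>v = j] - \<pi>\<^sub>j)\<close> to be bounded away
  from 0. The Cauchy--Schwarz inequality under \<open>R\<close> removes the algorithm: the mean square of that
  average is at most the square root of the mean of \<open>K(\<sigma>, \<tau>) h(\<sigma>, \<tau>)\<^sup>2\<close>, where \<open>K\<close> is the \<open>R\<close>-mean of
  the product of the two likelihood ratios and \<open>h\<close> is at most a constant times the distance of \<open>\<alpha>\<close>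
  from \<open>p\<close>.

  Up to a constant factor \<open>K\<close> is at most \<open>exp (n q(\<alpha> - p))\<close>, with \<open>q\<close> the quadratic form in the
  numerator of \<open>Q\<close>. Away from \<open>p\<close>, the method of types and the strict inequality \<open>q < D\<close> make the
  contribution exponentially small; as \<open>q < D\<close> is available only when both marginals of \<open>\<alpha>\<close> are
  nearly \<open>\<pi>\<close>, unbalanced labellings have to be discarded beforehand. Near \<open>p\<close>, the hypothesis gives
  \<open>q \<le> c/2 \<chi>\<^sup>2\<close> with \<open>c < 1\<close>, so that the exponential moment stays bounded and \<open>h\<^sup>2\<close> is small.
\<close>

section \<open>Finite sums over labellings\<close>

text \<open>Assigning the value \<open>d\<close> off \<open>A\<close> is a bijection from
  extensional functions, so the distributive law for \<open>PiE\<close> carries over.\<close>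

lemma sum_prod_PiE_dflt:
  fixes g :: "'a \<Rightarrow> 'b \<Rightarrow> real"
  assumes "finite A" "\<And>x. x \<in> A \<Longrightarrow> finite (B x)"
  shows "(\<Sum>f\<in>PiE_dflt A d B. \<Prod>x\<in>A. g x (f x)) = (\<Prod>x\<in>A. \<Sum>y\<in>B x. g x y)"
proof -
  have "(\<Sum>f\<in>PiE_dflt A d B. \<Prod>x\<in>A. g x (f x)) = (\<Sum>f\<in>PiE A B. \<Prod>x\<in>A. g x (f x))"
    unfolding dflt_image_PiE[symmetric]
  proof (subst sum.reindex)
    show "inj_on (\<lambda>h x. if x \<in> A then h x else d) (Pi\<^sub>E A B)"
    proof (rule inj_onI, rule PiE_ext)
      fix h h' x assume "(\<lambda>x. if x \<in> A then h x else d) = (\<lambda>x. if x \<in> A then h' x else d)" "x \<in> A"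
      then show "h x = h' x" by (metis (full_types))
    qed
  qed (auto intro!: sum.cong prod.cong)
  also have "\<dots> = (\<Prod>x\<in>A. \<Sum>y\<in>B x. g x y)"
    using assms by (intro prod_sum_PiE[symmetric])
  finally show ?thesis .
qed

text \<open>The default \<open>undefined\<close> off the vertices is the one that
  \<open>Pi_pmf\<close> uses in \<open>sbm\<close>, so this finite set carries the law of the
  labelling.\<close>

definition labellings :: "nat \<Rightarrow> 's::finite labelling set" where
  "labellings n = PiE_dflt {1..n} undefined (\<lambda>_. UNIV)"

text \<open>The expectation over independent labels of law \<open>\<pi>\<close>, written as a finite
  sum so that it can be handled algebraically.\<close>

definition label_avg :: "nat \<Rightarrow> 's::finite pmf \<Rightarrow> ('s labelling \<Rightarrow> real) \<Rightarrow> real" where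
  "label_avg n \<pi> F = (\<Sum>\<sigma>\<in>labellings n. (\<Prod>v\<in>{1..n}. pmf \<pi> (\<sigma> v)) * F \<sigma>)"

abbreviation label_avg2 ::
    "nat \<Rightarrow> 's::finite pmf \<Rightarrow> ('s labelling \<Rightarrow> 's labelling \<Rightarrow> real) \<Rightarrow> real" where
  "label_avg2 n \<pi> F \<equiv> label_avg n \<pi> (\<lambda>\<sigma>. label_avg n \<pi> (F \<sigma>))"

lemma finite_labellings [simp, intro]: "finite (labellings n :: 's::finite labelling set)"
  unfolding labellings_def by (rule finite_PiE_dflt) auto

text \<open>A labelling that uses a label of probability 0 has weight 0, so the comparison may
  assume that all labels in use have positive probability. This is how zero entries of
  \<open>\<pi>\<close> are accommodated.\<close>

lemma label_avg_mono:
  assumes "\<And>\<sigma>. \<sigma> \<in> labellings n \<Longrightarrow> (\<And>v. v \<in> {1..n} \<Longrightarrow> pmf \<pi> (\<sigma> v) > 0) \<Longrightarrow> F \<sigma> \<le> G \<sigma>"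
  shows "label_avg n \<pi> F \<le> label_avg n \<pi> G"
  unfolding label_avg_def
proof (rule sum_mono)
  fix \<sigma> :: "'a labelling" assume "\<sigma> \<in> labellings n"
  show "(\<Prod>v\<in>{1..n}. pmf \<pi> (\<sigma> v)) * F \<sigma> \<le> (\<Prod>v\<in>{1..n}. pmf \<pi> (\<sigma> v)) * G \<sigma>"
  proof (cases "\<forall>v\<in>{1..n}. pmf \<pi> (\<sigma> v) > 0")
    case True
    then show ?thesis using \<open>\<sigma> \<in> labellings n\<close>
      by (intro mult_left_mono assms prod_nonneg) auto
  next
    case False
    then obtain v where v: "v \<in> {1..n}" "pmf \<pi> (\<sigma> v) = 0"
      by (metis pmf_nonneg less_eq_real_def)
    then have z: "(\<Prod>v\<in>{1..n}. pmf \<pi> (\<sigma> v)) = 0" by (intro prod_zero) auto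
    show ?thesis unfolding z by simp
  qed
qed

lemma label_avg_cmult: "label_avg n \<pi> (\<lambda>\<sigma>. c * F \<sigma>) = c * label_avg n \<pi> F"
  unfolding label_avg_def by (simp add: sum_distrib_left mult_ac)

lemma label_avg_sum: "label_avg n \<pi> (\<lambda>\<sigma>. \<Sum>i\<in>I. F i \<sigma>) = (\<Sum>i\<in>I. label_avg n \<pi> (F i))"
  unfolding label_avg_def sum_distrib_left by (rule sum.swap)

lemma label_avg_add: "label_avg n \<pi> (\<lambda>\<sigma>. F \<sigma> + G \<sigma>) = label_avg n \<pi> F + label_avg n \<pi> G"
  unfolding label_avg_def by (simp add: distrib_left sum.distrib)

lemma label_avg_prod:
  "label_avg n \<pi> (\<lambda>\<sigma>. \<Prod>v\<in>{1..n}. f v (\<sigma> v)) = (\<Prod>v\<in>{1..n}. \<Sum>i\<in>UNIV. pmf \<pi> i * f v i)"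
  unfolding label_avg_def labellings_def prod.distrib[symmetric]
  by (rule sum_prod_PiE_dflt) auto

lemma label_avg2_prod:
  "label_avg2 n \<pi> (\<lambda>\<sigma> \<tau>. \<Prod>v\<in>{1..n}. f (\<sigma> v) (\<tau> v))
     = (\<Sum>i\<in>UNIV. \<Sum>j\<in>UNIV. pmf \<pi> i * pmf \<pi> j * f i j) ^ n"
proof -
  have "label_avg2 n \<pi> (\<lambda>\<sigma> \<tau>. \<Prod>v\<in>{1..n}. f (\<sigma> v) (\<tau> v))
      = label_avg n \<pi> (\<lambda>\<sigma>. \<Prod>v\<in>{1..n}. \<Sum>j\<in>UNIV. pmf \<pi> j * f (\<sigma> v) j)"
    using label_avg_prod[of n \<pi> "\<lambda>v. f (\<sigma> v)" for \<sigma>] by (intro arg_cong[where f="label_avg n \<pi>"] ext) 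
  also have "\<dots> = (\<Sum>i\<in>UNIV. pmf \<pi> i * (\<Sum>j\<in>UNIV. pmf \<pi> j * f i j)) ^ n"
    using label_avg_prod[of n \<pi> "\<lambda>v i. \<Sum>j\<in>UNIV. pmf \<pi> j * f i j"] by simp
  finally show ?thesis by (simp add: sum_distrib_left mult_ac)
qed

lemma label_avg2_cmult: "label_avg2 n \<pi> (\<lambda>\<sigma> \<tau>. c * F \<sigma> \<tau>) = c * label_avg2 n \<pi> F"
  by (simp add: label_avg_cmult)

lemma label_avg2_mono:
  assumes "\<And>\<sigma> \<tau>. \<sigma> \<in> labellings n \<Longrightarrow> \<tau> \<in> labellings n \<Longrightarrow> (\<And>v. v \<in> {1..n} \<Longrightarrow> pmf \<pi> (\<sigma> v) > 0 \<and> pmf \<pi> (\<tau> v) > 0) \<Longrightarrow> F \<sigma> \<tau> \<le> G \<sigma> \<tau>"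
  shows "label_avg2 n \<pi> F \<le> label_avg2 n \<pi> G"
  by (intro label_avg_mono assms) auto

section \<open>A second moment bound for posterior averages\<close>

lemma sum_swap_inner2:
  "(\<Sum>x\<in>A. \<Sum>s\<in>B. \<Sum>t\<in>C. f x s t) = (\<Sum>s\<in>B. \<Sum>t\<in>C. \<Sum>x\<in>A. f x s t)"
  by (subst sum.swap) (intro sum.cong refl sum.swap)

text \<open>Expanding the square gives a sum over pairs \<open>(u, v)\<close> and observations
  \<open>X\<close>. Cauchy--Schwarz separates the bounded factor \<open>x u X * x v X\<close> from
  one that is free of \<open>x\<close>; squaring the latter brings in the second copy
  \<open>\<tau>\<close>.\<close>

lemma second_moment_bound:
  fixes w :: "'l \<Rightarrow> real" and P :: "'l \<Rightarrow> 'x \<Rightarrow> real" and R :: "'x \<Rightarrow> real"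
    and x :: "'v \<Rightarrow> 'x \<Rightarrow> real" and y :: "'v \<Rightarrow> 'l \<Rightarrow> real"
  assumes fin: "finite \<Lambda>" "finite \<X>" "finite V"
    and R: "\<And>X. X \<in> \<X> \<Longrightarrow> R X > 0" "(\<Sum>X\<in>\<X>. R X) = 1"
    and x: "\<And>v X. \<bar>x v X\<bar> \<le> 1"
  shows "(\<Sum>\<sigma>\<in>\<Lambda>. w \<sigma> * (\<Sum>X\<in>\<X>. P \<sigma> X * (\<Sum>v\<in>V. x v X * y v \<sigma>)\<^sup>2))\<^sup>2
     \<le> (real (card V))\<^sup>2 * (\<Sum>\<sigma>\<in>\<Lambda>. w \<sigma> * (\<Sum>\<tau>\<in>\<Lambda>. w \<tau> *
          ((\<Sum>X\<in>\<X>. P \<sigma> X * P \<tau> X / R X) * (\<Sum>v\<in>V. y v \<sigma> * y v \<tau>)\<^sup>2)))"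
proof -
  \<comment> \<open>Up to normalisation, the posterior mean of \<open>y u * y v\<close> given
    \<open>X\<close>.\<close>
  define S where "S = (\<lambda>u v X. \<Sum>\<sigma>\<in>\<Lambda>. w \<sigma> * P \<sigma> X * y u \<sigma> * y v \<sigma>)"
  define I where "I = (V \<times> V) \<times> \<X>"
  \<comment> \<open>The weight \<open>sqrt (R X)\<close> is placed so that the squares of
    \<open>a\<close> sum to at most \<open>(real (card V))\<^sup>2\<close>, while those of
    \<open>b\<close> produce the kernel with \<open>R X\<close> in the denominator.\<close>
  define a where "a = (\<lambda>((u, v), X). x u X * x v X * sqrt (R X))"
  define b where "b = (\<lambda>((u, v), X). S u v X / sqrt (R X))"
  have ab: "a ((u, v), X) * b ((u, v), X) = x u X * x v X * S u v X" if "X \<in> \<X>" for u v X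
    using R(1)[OF that] by (simp add: a_def b_def)
  have "(\<Sum>\<sigma>\<in>\<Lambda>. w \<sigma> * (\<Sum>X\<in>\<X>. P \<sigma> X * (\<Sum>v\<in>V. x v X * y v \<sigma>)\<^sup>2))
      = (\<Sum>\<sigma>\<in>\<Lambda>. \<Sum>X\<in>\<X>. \<Sum>u\<in>V. \<Sum>v\<in>V. x u X * x v X * (w \<sigma> * P \<sigma> X * y u \<sigma> * y v \<sigma>))"
    by (simp add: power2_eq_square sum_product sum_distrib_left mult_ac)
  also have "\<dots> = (\<Sum>X\<in>\<X>. \<Sum>\<sigma>\<in>\<Lambda>. \<Sum>u\<in>V. \<Sum>v\<in>V. x u X * x v X * (w \<sigma> * P \<sigma> X * y u \<sigma> * y v \<sigma>))"
    by (rule sum.swap)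
  also have "\<dots> = (\<Sum>X\<in>\<X>. \<Sum>u\<in>V. \<Sum>\<sigma>\<in>\<Lambda>. \<Sum>v\<in>V. x u X * x v X * (w \<sigma> * P \<sigma> X * y u \<sigma> * y v \<sigma>))"
    by (intro sum.cong refl sum.swap)
  also have "\<dots> = (\<Sum>X\<in>\<X>. \<Sum>u\<in>V. \<Sum>v\<in>V. \<Sum>\<sigma>\<in>\<Lambda>. x u X * x v X * (w \<sigma> * P \<sigma> X * y u \<sigma> * y v \<sigma>))"
    by (intro sum.cong refl sum.swap)
  also have "\<dots> = (\<Sum>X\<in>\<X>. \<Sum>u\<in>V. \<Sum>v\<in>V. a ((u, v), X) * b ((u, v), X))"
    by (intro sum.cong refl) (simp add: ab S_def sum_distrib_left)
  also have "\<dots> = (\<Sum>i\<in>I. a i * b i)"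
    unfolding I_def sum_swap_inner2[of _ _ _ \<X>] by (simp add: sum.cartesian_product')
  finally have L: "(\<Sum>\<sigma>\<in>\<Lambda>. w \<sigma> * (\<Sum>X\<in>\<X>. P \<sigma> X * (\<Sum>v\<in>V. x v X * y v \<sigma>)\<^sup>2)) = (\<Sum>i\<in>I. a i * b i)" .
  have "(\<Sum>i\<in>I. (a i)\<^sup>2) \<le> (\<Sum>i\<in>I. R (snd i))"
  proof (rule sum_mono)
    fix i assume "i \<in> I"
    then obtain u v X where i: "i = ((u, v), X)" "X \<in> \<X>" by (auto simp: I_def)
    have "(x u X * x v X)\<^sup>2 \<le> 1"
      using x[of u X] x[of v X] by (simp add: power_mult_distrib abs_square_le_1 mult_le_one)
    then show "(a i)\<^sup>2 \<le> R (snd i)"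
      using R(1)[OF i(2)] unfolding i a_def by (simp add: power_mult_distrib mult_left_le_one_le)
  qed
  also have "\<dots> = (real (card V))\<^sup>2"
    unfolding I_def using R(2)
    by (simp add: sum.cartesian_product' power2_eq_square card_cartesian_product)
  finally have A: "(\<Sum>i\<in>I. (a i)\<^sup>2) \<le> (real (card V))\<^sup>2" .
  define C where "C \<sigma> \<tau> = (\<Sum>X\<in>\<X>. P \<sigma> X * P \<tau> X / R X)" for \<sigma> \<tau>
  have C: "(\<Sum>X\<in>\<X>. P \<sigma> X * P \<tau> X / R X) = C \<sigma> \<tau>" for \<sigma> \<tau>
    by (simp add: C_def)
  have "(\<Sum>i\<in>I. (b i)\<^sup>2) = (\<Sum>u\<in>V. \<Sum>v\<in>V. \<Sum>X\<in>\<X>. (S u v X)\<^sup>2 / R X)"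
    unfolding I_def using R(1)
    by (auto intro!: sum.cong simp: sum.cartesian_product' b_def power_divide less_imp_le)
  also have "\<dots> = (\<Sum>u\<in>V. \<Sum>v\<in>V. \<Sum>X\<in>\<X>. \<Sum>\<sigma>\<in>\<Lambda>. \<Sum>\<tau>\<in>\<Lambda>.
      w \<sigma> * w \<tau> * (P \<sigma> X * P \<tau> X / R X) * ((y u \<sigma> * y u \<tau>) * (y v \<sigma> * y v \<tau>)))"
    unfolding S_def power2_eq_square sum_product sum_divide_distrib
    by (simp add: mult_ac)
  also have "\<dots> = (\<Sum>u\<in>V. \<Sum>v\<in>V. \<Sum>\<sigma>\<in>\<Lambda>. \<Sum>\<tau>\<in>\<Lambda>.
      w \<sigma> * w \<tau> * (\<Sum>X\<in>\<X>. P \<sigma> X * P \<tau> X / R X) * ((y u \<sigma> * y u \<tau>) * (y v \<sigma> * y v \<tau>)))"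
    by (simp only: sum_distrib_left sum_distrib_right sum_swap_inner2[of _ _ _ \<X>])
  also have "\<dots> = (\<Sum>\<sigma>\<in>\<Lambda>. \<Sum>\<tau>\<in>\<Lambda>. \<Sum>u\<in>V. \<Sum>v\<in>V.
      w \<sigma> * w \<tau> * (\<Sum>X\<in>\<X>. P \<sigma> X * P \<tau> X / R X) * ((y u \<sigma> * y u \<tau>) * (y v \<sigma> * y v \<tau>)))"
    by (simp only: sum_swap_inner2[of _ \<Lambda> \<Lambda> V])
  \<comment> \<open>The factors in \<open>u\<close> and \<open>v\<close> separate, so the double sum
    over vertices is the square of a single one.\<close>
  also have "\<dots> = (\<Sum>\<sigma>\<in>\<Lambda>. w \<sigma> * (\<Sum>\<tau>\<in>\<Lambda>. w \<tau> *
          ((\<Sum>X\<in>\<X>. P \<sigma> X * P \<tau> X / R X) * (\<Sum>v\<in>V. y v \<sigma> * y v \<tau>)\<^sup>2)))"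
    unfolding C power2_eq_square sum_product by (simp add: sum_distrib_left mult_ac)
  finally have B: "(\<Sum>i\<in>I. (b i)\<^sup>2) = \<dots>" .
  have "(\<Sum>i\<in>I. a i * b i)\<^sup>2 \<le> (\<Sum>i\<in>I. (a i)\<^sup>2) * (\<Sum>i\<in>I. (b i)\<^sup>2)"
    by (rule Cauchy_Schwarz_ineq_sum)
  also have "\<dots> \<le> (real (card V))\<^sup>2 * (\<Sum>i\<in>I. (b i)\<^sup>2)"
    by (intro mult_right_mono A sum_nonneg) auto
  finally show ?thesis unfolding L B .
qed

section \<open>The quadratic form and the divergence\<close>

definition kron_form :: "real ^ 's ^ 's \<Rightarrow> real ^ ('s::finite \<times> 's) \<Rightarrow> real" where
  "kron_form B x = x \<bullet> (kronecker B B *v x)"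

lemma sum_UNIV_prod: "(\<Sum>k\<in>UNIV. f k) = (\<Sum>i\<in>UNIV. \<Sum>j\<in>UNIV. f (i, j))"
  for f :: "('a::finite \<times> 'b::finite) \<Rightarrow> real"
  by (simp only: UNIV_Times_UNIV[symmetric] sum.cartesian_product')

lemma kron_form_expand:
  "kron_form B x = (\<Sum>k\<in>UNIV. \<Sum>l\<in>UNIV.
     x $ k * x $ l * (B $ fst k $ fst l * B $ snd k $ snd l))"
  unfolding kron_form_def inner_vec_def matrix_vector_mult_def kronecker_def
  by (simp add: sum_distrib_left mult_ac)

lemma kron_form_scaleR: "kron_form B (c *\<^sub>R x) = c\<^sup>2 * kron_form B x"
  unfolding kron_form_expand by (simp add: sum_distrib_left power2_eq_square mult_ac)

lemma continuous_kron_form: "continuous_on UNIV (kron_form B)"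
  unfolding kron_form_expand by (intro continuous_intros)

text \<open>As \<open>B\<close> annihilates \<open>\<pi>\<close>, the vectors
  \<open>a \<otimes> \<pi> + \<pi> \<otimes> b\<close> lie in the kernel of the symmetric matrix
  \<open>B \<otimes> B\<close>. This permits a correction of the marginals of \<open>x\<close> later
  on.\<close>

lemma kron_form_add_kernel:
  fixes a b :: "'s::finite \<Rightarrow> real"
  assumes sym: "transpose B = B" and B\<pi>: "\<And>i. (\<Sum>j\<in>UNIV. B $ i $ j * pmf \<pi> j) = 0"
  shows "kron_form B (x + (\<chi> k. a (fst k) * pmf \<pi> (snd k) + pmf \<pi> (fst k) * b (snd k))) = kron_form B x"
proof -
  define z :: "real ^ ('s \<times> 's)"
    where "z = (\<chi> k. a (fst k) * pmf \<pi> (snd k) + pmf \<pi> (fst k) * b (snd k))"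
  define K where "K = kronecker B B"
  have symB: "B $ i $ j = B $ j $ i" for i j
    using sym by (metis transpose_def vec_lambda_beta)
  have KT: "transpose K = K"
    unfolding K_def kronecker_def transpose_def by (simp add: vec_eq_iff symB)
  have Kz: "K *v z = 0"
  proof -
    have "(K *v z) $ k = 0" for k
    proof -
      obtain i j where k: "k = (i, j)" by (cases k)
      have "(K *v z) $ k = (\<Sum>m\<in>UNIV. B $ i $ m * a m * (\<Sum>l\<in>UNIV. B $ j $ l * pmf \<pi> l))
         + (\<Sum>m\<in>UNIV. B $ i $ m * pmf \<pi> m) * (\<Sum>l\<in>UNIV. B $ j $ l * b l)"
        unfolding K_def kronecker_def matrix_vector_mult_def z_def k
        by (simp add: sum_UNIV_prod sum_product sum_distrib_left sum.distrib[symmetric] algebra_simps)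
      then show ?thesis by (simp add: B\<pi>)
    qed
    then show ?thesis by (simp add: vec_eq_iff)
  qed
  have "z \<bullet> (K *v x) = 0"
    by (metis KT Kz dot_lmul_matrix inner_zero_left vector_transpose_matrix)
  then show ?thesis
    unfolding kron_form_def z_def[symmetric] K_def[symmetric]
    by (simp add: matrix_vector_right_distrib Kz inner_add_left)
qed

text \<open>The product coupling is itself one of these kernel vectors.\<close>

lemma kron_form_minus_product_coupling:
  assumes "transpose B = B" "\<And>i. (\<Sum>j\<in>UNIV. B $ i $ j * pmf \<pi> j) = 0"
  shows "kron_form B (x - product_coupling \<pi>) = kron_form B x"
proof -
  have "x - product_coupling \<pi>
      = x + (\<chi> k. - pmf \<pi> (fst k) * pmf \<pi> (snd k) + pmf \<pi> (fst k) * 0)"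
    by (simp add: vec_eq_iff product_coupling_def)
  then show ?thesis
    using kron_form_add_kernel[OF assms, of x "\<lambda>i. - pmf \<pi> i" "\<lambda>_. 0"] by (simp only:)
qed

section \<open>Logarithmic inequalities and positivity of the divergence\<close>

text \<open>For \<open>x > 0\<close> this is \<open>ln y < y - 1\<close> at
  \<open>y = p / x\<close>, multiplied by \<open>x\<close>.\<close>

lemma xlnx_gt:
  fixes x p :: real
  assumes "x \<ge> 0" "p > 0" "x \<noteq> p"
  shows "x * ln (x / p) > x - p"
proof (cases "x = 0")
  case False
  with assms have "x > 0" by simp
  have "ln (p / x) < p / x - 1"
    using ln_le_minus_one[of "p / x"] ln_eq_minus_one[of "p / x"] \<open>x > 0\<close> assms by fastforce
  then have "x * ln (p / x) < x * (p / x - 1)" using \<open>x > 0\<close> by simp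
  then show ?thesis using \<open>x > 0\<close> assms by (simp add: ln_div algebra_simps)
qed (use assms in auto)

lemma xlnx_ge:
  fixes x p :: real
  assumes "x \<ge> 0" "p > 0"
  shows "x * ln (x / p) \<ge> x - p"
  using xlnx_gt[OF assms] assms by (cases "x = p") auto

text \<open>The difference of the two sides has derivative \<open>x ^ 3 / (1 + x)\<close>, which has
  the sign of \<open>x\<close>; hence its minimum is its value 0 at 0.\<close>

lemma ln_upper_cubic:
  fixes u :: real
  assumes "u > -1"
  shows "ln (1 + u) \<le> u - u\<^sup>2 / 2 + u ^ 3 / 3"
proof -
  define g where "g = (\<lambda>u::real. u - u\<^sup>2 / 2 + u ^ 3 / 3 - ln (1 + u))"
  have g': "(g has_real_derivative x ^ 3 / (1 + x)) (at x)" if "x > -1" for x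
    unfolding g_def using that
    by (auto intro!: derivative_eq_intros simp: field_simps power2_eq_square power3_eq_cube)
  have "g u \<ge> g 0"
  proof (cases "u \<ge> 0")
    case True
    show ?thesis
    proof (rule DERIV_nonneg_imp_nondecreasing[OF True])
      fix x :: real assume "0 \<le> x" "x \<le> u"
      then show "\<exists>y. (g has_real_derivative y) (at x) \<and> 0 \<le> y"
        using g'[of x] by (intro exI[of _ "x ^ 3 / (1 + x)"]) auto
    qed
  next
    case False
    show ?thesis
    proof (rule DERIV_nonpos_imp_nonincreasing[where f = g])
      show "u \<le> 0" using False by simp
      fix x :: real assume x: "u \<le> x" "x \<le> 0"
      then have "x ^ 3 / (1 + x) \<le> 0"
        using assms by (intro divide_nonpos_nonneg) (auto simp: power3_eq_cube mult_nonneg_nonpos mult_nonpos_nonpos)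
      then show "\<exists>y. (g has_real_derivative y) (at x) \<and> y \<le> 0"
        using g'[of x] x assms by (intro exI[of _ "x ^ 3 / (1 + x)"]) auto
    qed
  qed
  then show ?thesis by (simp add: g_def)
qed

lemma product_coupling_nth [simp]: "product_coupling \<pi> $ (i, j) = pmf \<pi> i * pmf \<pi> j"
  by (simp add: product_coupling_def)

lemma product_coupling_nonneg: "product_coupling \<pi> $ k \<ge> 0"
  by (cases k) simp

lemma sum_product_coupling: "(\<Sum>k\<in>UNIV. product_coupling \<pi> $ k) = 1"
  by (simp add: sum_UNIV_prod sum_product[symmetric] sum_pmf_eq_1)

lemma KL_div_product_coupling_self [simp]: "KL_div (product_coupling \<pi>) (product_coupling \<pi>) = 0"
  unfolding KL_div_def by (intro sum.neutral) auto

text \<open>Gibbs' inequality: each summand is at least \<open>\<alpha> $ k - p $ k\<close>,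
  strictly so where the two differ, and these lower bounds cancel because the total masses
  agree.\<close>

lemma KL_div_pos:
  fixes \<alpha> p :: "real ^ 'k::finite"
  assumes "\<And>k. \<alpha> $ k \<ge> 0" "\<And>k. p $ k \<ge> 0" "\<And>k. p $ k = 0 \<Longrightarrow> \<alpha> $ k = 0"
    and "(\<Sum>k\<in>UNIV. \<alpha> $ k) = (\<Sum>k\<in>UNIV. p $ k)" "\<alpha> \<noteq> p"
  shows "KL_div \<alpha> p > 0"
proof -
  have ge: "\<alpha> $ k * ln (\<alpha> $ k / p $ k) \<ge> \<alpha> $ k - p $ k" for k
    using xlnx_ge[of "\<alpha> $ k" "p $ k"] assms(1-3)[of k] by (cases "p $ k = 0") auto
  obtain k where k: "\<alpha> $ k \<noteq> p $ k" using assms(5) by (auto simp: vec_eq_iff)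
  then have "\<alpha> $ k * ln (\<alpha> $ k / p $ k) > \<alpha> $ k - p $ k"
    using xlnx_gt[of "\<alpha> $ k" "p $ k"] assms(1-3)[of k] by (cases "p $ k = 0") auto
  then have "(\<Sum>k\<in>UNIV. \<alpha> $ k - p $ k) < KL_div \<alpha> p"
    unfolding KL_div_def using ge by (intro sum_strict_mono_ex1) auto
  then show ?thesis using assms(4) by (simp add: sum_subtractf)
qed

text \<open>A vanishing marginal is a sum of non-negative entries, so its whole row or column
  vanishes.\<close>

lemma couplings_supp:
  assumes "\<alpha> \<in> couplings \<pi>" "product_coupling \<pi> $ k = 0"
  shows "\<alpha> $ k = 0"
proof -
  obtain i j where k: "k = (i, j)" by (cases k)
  from assms have *: "\<And>i j. 0 \<le> \<alpha> $ (i, j)" "(\<Sum>i\<in>UNIV. \<alpha> $ (i, j)) = pmf \<pi> j"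
    "(\<Sum>j\<in>UNIV. \<alpha> $ (i, j)) = pmf \<pi> i" by (auto simp: couplings_def)
  have "pmf \<pi> i = 0 \<or> pmf \<pi> j = 0" using assms(2) k by simp
  then show ?thesis
    using * k by (auto simp: sum_nonneg_eq_0_iff)
qed

lemma sum_coupling:
  assumes "\<alpha> \<in> couplings \<pi>" shows "(\<Sum>k\<in>UNIV. \<alpha> $ k) = 1"
  using assms by (simp add: sum_UNIV_prod couplings_def sum_pmf_eq_1)

text \<open>Off \<open>p\<close> the divergence is positive, so the bound on the quotient can be
  multiplied out; at \<open>p\<close> both sides are 0.\<close>

lemma Q_less_one_imp:
  assumes "Q \<pi> B < 1"
  obtains c where "0 \<le> c" "c < 1"
    "\<And>\<alpha>. \<alpha> \<in> couplings \<pi> \<Longrightarrow>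
       kron_form B (\<alpha> - product_coupling \<pi>) \<le> c * KL_div \<alpha> (product_coupling \<pi>)"
proof
  \<comment> \<open>The maximum with 0 makes \<open>c\<close> non-negative and replaces the value
    \<open>-\<infinity>\<close> of an empty supremum by a real number.\<close>
  define c where "c = real_of_ereal (max 0 (Q \<pi> B))"
  have c: "ereal c = max 0 (Q \<pi> B)" 
    unfolding c_def using assms by (intro ereal_real') (auto simp: max_def)
  show "0 \<le> c" unfolding c_def by (simp add: real_of_ereal_pos)
  have "ereal c < 1" using c assms by simp
  then show "c < 1" by simp
  fix \<alpha> assume \<alpha>: "\<alpha> \<in> couplings \<pi>"
  let ?p = "product_coupling \<pi>"
  show "kron_form B (\<alpha> - ?p) \<le> c * KL_div \<alpha> ?p"
  proof (cases "\<alpha> = ?p")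
    case True
    then show ?thesis by (simp add: kron_form_def)
  next
    case False
    have "KL_div \<alpha> ?p > 0"
      using \<alpha> False couplings_supp[OF \<alpha>]
      by (intro KL_div_pos) (auto simp: product_coupling_nonneg sum_product_coupling sum_coupling[OF \<alpha>] couplings_def)
    moreover have "ereal (kron_form B (\<alpha> - ?p) / KL_div \<alpha> ?p) \<le> Q \<pi> B"
      unfolding Q_def Let_def kron_form_def using \<alpha> False by (intro SUP_upper) auto
    then have "ereal (kron_form B (\<alpha> - ?p) / KL_div \<alpha> ?p) \<le> ereal c"
      unfolding c by (simp add: max.coboundedI2)
    ultimately show ?thesis by (simp add: field_simps)
  qed
qed

section \<open>The functional near the product coupling\<close>

text \<open>Twice the second-order term of \<open>KL_div (p + x) p\<close> at \<open>x = 0\<close>.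
  Coordinates with \<open>p $ k = 0\<close> contribute 0, by the convention for division by
  zero.\<close>

definition chi2 :: "real ^ 'k::finite \<Rightarrow> real ^ 'k \<Rightarrow> real" where
  "chi2 p x = (\<Sum>k\<in>UNIV. (x $ k)\<^sup>2 / p $ k)"

text \<open>For small \<open>t > 0\<close> the vector \<open>p + t \<gamma>\<close> is a coupling.
  Its form is \<open>t\<^sup>2\<close> times that of \<open>\<gamma>\<close>, and its divergence is
  \<open>t\<^sup>2 / 2\<close> times \<open>chi2\<close> to leading order; dividing by
  \<open>t\<^sup>2\<close> and letting \<open>t\<close> tend to 0 gives the claim.\<close>

lemma kron_form_le_chi2_coupling:
  assumes c: "0 \<le> c" "\<And>\<alpha>. \<alpha> \<in> couplings \<pi> \<Longrightarrow>
       kron_form B (\<alpha> - product_coupling \<pi>) \<le> c * KL_div \<alpha> (product_coupling \<pi>)"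
    and \<gamma>: "\<And>i. (\<Sum>j\<in>UNIV. \<gamma> $ (i, j)) = 0" "\<And>j. (\<Sum>i\<in>UNIV. \<gamma> $ (i, j)) = 0"
      "\<And>k. product_coupling \<pi> $ k = 0 \<Longrightarrow> \<gamma> $ k = 0"
  shows "kron_form B \<gamma> \<le> c / 2 * chi2 (product_coupling \<pi>) \<gamma>"
proof -
  let ?p = "product_coupling \<pi>"
  define u where "u k = \<gamma> $ k / ?p $ k" for k
  have pu: "?p $ k * u k = \<gamma> $ k" for k
    using \<gamma>(3)[of k] by (cases "?p $ k = 0") (auto simp: u_def)
  \<comment> \<open>With \<open>v = t * u k\<close>, the cubic bound on \<open>ln (1 + v)\<close>
    multiplied by \<open>1 + v\<close> is \<open>v + v\<^sup>2 / 2 - v ^ 3 / 6 + v ^ 4 / 3\<close>;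
    \<open>R t\<close> collects all but the linear term, divided by
    \<open>t\<^sup>2\<close>.\<close>
  define R where "R t = (\<Sum>k\<in>UNIV. ?p $ k * ((u k)\<^sup>2 / 2 - t * (u k) ^ 3 / 6 + t\<^sup>2 * (u k) ^ 4 / 3))" for t
  have ev: "eventually (\<lambda>t. 1 + t * u k > 0) (at_right (0::real))" for k
  proof -
    have "((\<lambda>t. 1 + t * u k) \<longlongrightarrow> 1 + 0 * u k) (at_right 0)" by (intro tendsto_intros)
    then show ?thesis by (rule order_tendstoD(1)) simp
  qed
  have "eventually (\<lambda>t. t > 0 \<and> (\<forall>k. 1 + t * u k > 0)) (at_right (0::real))"
    using ev by (intro eventually_conj eventually_all_finite) (auto simp: eventually_at_right_less)
  then have "eventually (\<lambda>t. kron_form B \<gamma> \<le> c * R t) (at_right (0::real))"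
  proof eventually_elim
    case (elim t)
    then have t: "t > 0" "\<And>k. 1 + t * u k > 0" by auto
    let ?\<alpha> = "?p + t *\<^sub>R \<gamma>"
    have \<alpha>k: "?\<alpha> $ k = ?p $ k * (1 + t * u k)" for k
      using pu[of k] by (simp add: algebra_simps)
    have "?\<alpha> \<in> couplings \<pi>"
      unfolding couplings_def
    proof (intro CollectI conjI allI)
      show "0 \<le> ?\<alpha> $ (i, j)" for i j
        unfolding \<alpha>k using product_coupling_nonneg t(2)[of "(i, j)"] by (intro mult_nonneg_nonneg) auto
      show "(\<Sum>i\<in>UNIV. ?\<alpha> $ (i, j)) = pmf \<pi> j" for j
        by (simp add: sum.distrib sum_distrib_left[symmetric] sum_distrib_right[symmetric] \<gamma> sum_pmf_eq_1)
      show "(\<Sum>j\<in>UNIV. ?\<alpha> $ (i, j)) = pmf \<pi> i" for i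
        by (simp add: sum.distrib sum_distrib_left[symmetric] sum_distrib_right[symmetric] \<gamma> sum_pmf_eq_1)
    qed
    then have "kron_form B (?\<alpha> - ?p) \<le> c * KL_div ?\<alpha> ?p" by (rule c)
    then have q: "t\<^sup>2 * kron_form B \<gamma> \<le> c * KL_div ?\<alpha> ?p" by (simp add: kron_form_scaleR)
    have "KL_div ?\<alpha> ?p \<le> (\<Sum>k\<in>UNIV. ?p $ k * (t * u k) +
        t\<^sup>2 * (?p $ k * ((u k)\<^sup>2 / 2 - t * (u k) ^ 3 / 6 + t\<^sup>2 * (u k) ^ 4 / 3)))"
      unfolding KL_div_def
    proof (rule sum_mono)
      fix k
      define v where "v = t * u k"
      have v: "1 + v > 0" using t(2)[of k] by (simp add: v_def)
      have "ln (?\<alpha> $ k / ?p $ k) = ln (1 + v)" if "?p $ k \<noteq> 0"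
        using that unfolding \<alpha>k v_def by simp
      then have "?\<alpha> $ k * ln (?\<alpha> $ k / ?p $ k) = ?p $ k * ((1 + v) * ln (1 + v))"
        unfolding \<alpha>k[of k] v_def by (cases "?p $ k = 0") auto
      also have "\<dots> \<le> ?p $ k * ((1 + v) * (v - v\<^sup>2 / 2 + v ^ 3 / 3))"
        using v by (intro mult_left_mono ln_upper_cubic product_coupling_nonneg) auto
      also have "(1 + v) * (v - v\<^sup>2 / 2 + v ^ 3 / 3) = v + t\<^sup>2 * ((u k)\<^sup>2 / 2 - t * (u k) ^ 3 / 6 + t\<^sup>2 * (u k) ^ 4 / 3)"
        unfolding v_def by (simp add: field_simps power2_eq_square power3_eq_cube power4_eq_xxxx)
      finally show "?\<alpha> $ k * ln (?\<alpha> $ k / ?p $ k) \<le> ?p $ k * (t * u k) +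
        t\<^sup>2 * (?p $ k * ((u k)\<^sup>2 / 2 - t * (u k) ^ 3 / 6 + t\<^sup>2 * (u k) ^ 4 / 3))"
        by (simp add: v_def algebra_simps)
    qed
    also have "\<dots> = t * (\<Sum>k\<in>UNIV. \<gamma> $ k) + t\<^sup>2 * R t"
      unfolding sum.distrib R_def sum_distrib_left pu[symmetric] by (simp add: mult_ac)
    \<comment> \<open>The first-order term disappears, so both sides are of order
      \<open>t\<^sup>2\<close>.\<close>
    also have "(\<Sum>k\<in>UNIV. \<gamma> $ k) = 0" by (simp add: sum_UNIV_prod \<gamma>)
    finally have "c * KL_div ?\<alpha> ?p \<le> c * (t\<^sup>2 * R t)"
      using c(1) by (intro mult_left_mono) auto
    with q have "t\<^sup>2 * kron_form B \<gamma> \<le> t\<^sup>2 * (c * R t)" by (simp add: mult_ac)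
    then show ?case using t(1) by simp
  qed
  moreover have "((\<lambda>t. c * R t) \<longlongrightarrow> c * R 0) (at_right 0)"
    unfolding R_def by (intro tendsto_intros) auto
  ultimately have "kron_form B \<gamma> \<le> c * R 0"
    by (intro tendsto_lowerbound) auto
  also have "R 0 = chi2 ?p \<gamma> / 2"
    unfolding R_def chi2_def sum_divide_distrib
  proof (rule sum.cong)
    show "?p $ k * ((u k)\<^sup>2 / 2 - 0 * u k ^ 3 / 6 + 0\<^sup>2 * u k ^ 4 / 3) = (\<gamma> $ k)\<^sup>2 / ?p $ k / 2" for k
      by (cases "?p $ k = 0") (auto simp: u_def power2_eq_square)
  qed auto
  finally show ?thesis by simp
qed

text \<open>Removes the condition on the marginals, since empirical marginals are only close to
  \<open>\<pi>\<close>. In \<open>x = \<gamma> + z\<close> the part \<open>z\<close> carries the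
  marginals and lies in the kernel of the form, and \<open>\<gamma>\<close> is orthogonal to
  \<open>z\<close> for the inner product with weights \<open>1 / p\<close>, so \<open>chi2\<close>
  only decreases.\<close>

lemma kron_form_le_chi2:
  fixes x :: "real ^ ('s::finite \<times> 's)"
  assumes c: "0 \<le> c" "\<And>\<alpha>. \<alpha> \<in> couplings \<pi> \<Longrightarrow>
       kron_form B (\<alpha> - product_coupling \<pi>) \<le> c * KL_div \<alpha> (product_coupling \<pi>)"
    and B: "transpose B = B" "\<And>i. (\<Sum>j\<in>UNIV. B $ i $ j * pmf \<pi> j) = 0"
    and x: "(\<Sum>k\<in>UNIV. x $ k) = 0" "\<And>k. product_coupling \<pi> $ k = 0 \<Longrightarrow> x $ k = 0"
  shows "kron_form B x \<le> c / 2 * chi2 (product_coupling \<pi>) x"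
proof -
  let ?p = "product_coupling \<pi>"
  define a where "a i = (\<Sum>j\<in>UNIV. x $ (i, j))" for i
  define b where "b j = (\<Sum>i\<in>UNIV. x $ (i, j))" for j
  define z :: "real ^ ('s \<times> 's)" where "z = (\<chi> k. a (fst k) * pmf \<pi> (snd k) + pmf \<pi> (fst k) * b (snd k))"
  define \<gamma> where "\<gamma> = x - z"
  have sa: "(\<Sum>i\<in>UNIV. a i) = 0" using x(1) by (simp add: a_def sum_UNIV_prod)
  have sb: "(\<Sum>i\<in>UNIV. b i) = 0"
    using x(1) unfolding b_def by (subst sum.swap) (simp add: sum_UNIV_prod)
  have a0: "a i = 0" if "pmf \<pi> i = 0" for i
    unfolding a_def using that x(2) by (intro sum.neutral) auto
  have b0: "b i = 0" if "pmf \<pi> i = 0" for i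
    unfolding b_def using that x(2) by (intro sum.neutral) auto
  have \<gamma>1: "(\<Sum>j\<in>UNIV. \<gamma> $ (i, j)) = 0" for i
    by (simp add: \<gamma>_def z_def sum_subtractf sum.distrib sum_distrib_left[symmetric] sb sum_pmf_eq_1 a_def[symmetric])
  have \<gamma>2: "(\<Sum>i\<in>UNIV. \<gamma> $ (i, j)) = 0" for j
    by (simp add: \<gamma>_def z_def sum_subtractf sum.distrib sum_distrib_right[symmetric] sa sum_pmf_eq_1 b_def[symmetric])
  have \<gamma>3: "\<gamma> $ k = 0" if "?p $ k = 0" for k
    using that x(2)[of k] a0 b0 by (cases k) (auto simp: \<gamma>_def z_def)
  have "x = \<gamma> + z" by (simp add: \<gamma>_def)
  then have "kron_form B x = kron_form B \<gamma>"
    unfolding z_def by (simp only: kron_form_add_kernel[OF B])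
  also have "\<dots> \<le> c / 2 * chi2 ?p \<gamma>"
    by (rule kron_form_le_chi2_coupling[OF c \<gamma>1 \<gamma>2 \<gamma>3])
  also have "chi2 ?p \<gamma> \<le> chi2 ?p x"
  proof -
    \<comment> \<open>On the support of \<open>p\<close>, \<open>z / p\<close> is a function of
      \<open>i\<close> plus a function of \<open>j\<close>, and \<open>\<gamma>\<close> has zero
      marginals.\<close>
    have "(\<Sum>k\<in>UNIV. \<gamma> $ k * z $ k / ?p $ k)
        = (\<Sum>i\<in>UNIV. \<Sum>j\<in>UNIV. \<gamma> $ (i, j) * (a i / pmf \<pi> i) + \<gamma> $ (i, j) * (b j / pmf \<pi> j))"
      unfolding sum_UNIV_prod
    proof (intro sum.cong refl)
      fix i j
      show "\<gamma> $ (i, j) * z $ (i, j) / ?p $ (i, j) = \<gamma> $ (i, j) * (a i / pmf \<pi> i) + \<gamma> $ (i, j) * (b j / pmf \<pi> j)"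
        using \<gamma>3[of "(i, j)"] by (cases "pmf \<pi> i = 0 \<or> pmf \<pi> j = 0") (auto simp: z_def field_simps)
    qed
    also have "\<dots> = (\<Sum>i\<in>UNIV. \<Sum>j\<in>UNIV. \<gamma> $ (i, j) * (a i / pmf \<pi> i))
        + (\<Sum>j\<in>UNIV. \<Sum>i\<in>UNIV. \<gamma> $ (i, j) * (b j / pmf \<pi> j))"
      by (simp add: sum.distrib) (rule sum.swap)
    also have "\<dots> = 0" by (simp only: sum_distrib_right[symmetric] \<gamma>1 \<gamma>2) simp
    finally have ort: "(\<Sum>k\<in>UNIV. \<gamma> $ k * z $ k / ?p $ k) = 0" .
    have "chi2 ?p x = chi2 ?p \<gamma> + 2 * (\<Sum>k\<in>UNIV. \<gamma> $ k * z $ k / ?p $ k) + chi2 ?p z"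
      unfolding \<open>x = \<gamma> + z\<close> chi2_def sum_distrib_left sum.distrib[symmetric]
      by (simp add: power2_sum add_divide_distrib mult_ac add_ac)
    moreover have "chi2 ?p z \<ge> 0"
      unfolding chi2_def by (intro sum_nonneg divide_nonneg_nonneg product_coupling_nonneg) auto
    ultimately show ?thesis using ort by simp
  qed
  finally show ?thesis using c(1) by (simp add: mult_left_mono)
qed

section \<open>Continuity of the divergence and a compactness argument\<close>

text \<open>Only the point 0 needs an argument; there
  \<open>\<bar>x * ln x\<bar> \<le> 2 * sqrt x + x\<^sup>2\<close>, the lower bound coming from
  \<open>ln y \<le> y - 1\<close> at \<open>y = 1 / sqrt x\<close>.\<close>

lemma continuous_on_xlnx: "continuous_on {0..} (\<lambda>x::real. x * ln (x / p))" if "p > 0"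
proof -
  have lim0: "((\<lambda>x::real. x * ln x) \<longlongrightarrow> 0) (at 0 within {0..})"
  proof (rule tendsto_rabs_zero_cancel, rule tendsto_sandwich[where f = "\<lambda>_. 0" and h = "\<lambda>x. 2 * sqrt x + x\<^sup>2"])
    show "((\<lambda>x::real. 2 * sqrt x + x\<^sup>2) \<longlongrightarrow> 0) (at 0 within {0..})"
      by (rule tendsto_eq_intros refl | simp)+
    show "eventually (\<lambda>x::real. \<bar>x * ln x\<bar> \<le> 2 * sqrt x + x\<^sup>2) (at 0 within {0..})"
      unfolding eventually_at_filter
    proof (intro always_eventually allI impI)
      fix x :: real assume "x \<noteq> 0" "x \<in> {0..}"
      then have x: "x > 0" by simp
      have upper: "x * ln x \<le> x * x" using ln_le_minus_one[OF x] x by (intro mult_left_mono) auto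
      have "- ln x \<le> 2 / sqrt x"
        using ln_le_minus_one[of "1 / sqrt x"] x by (simp add: ln_div ln_sqrt)
      then have "x * (- ln x) \<le> x * (2 / sqrt x)" using x by (intro mult_left_mono) auto
      also have "x * (2 / sqrt x) = 2 * (x / sqrt x)" by simp
      also have "x / sqrt x = sqrt x" using x by (intro real_div_sqrt) simp
      finally have "- (x * ln x) \<le> 2 * sqrt x" by simp
      with upper show "\<bar>x * ln x\<bar> \<le> 2 * sqrt x + x\<^sup>2"
        using x by (auto simp: abs_if power2_eq_square intro: add_increasing add_increasing2)
    qed
  qed auto
  have "continuous_on {0..} (\<lambda>x::real. x * ln x)"
    unfolding continuous_on_def
  proof
    fix x :: real assume "x \<in> {0..}"
    then show "((\<lambda>x. x * ln x) \<longlongrightarrow> x * ln x) (at x within {0..})"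
      using lim0 by (cases "x = 0") (auto intro!: tendsto_intros)
  qed
  then have "continuous_on {0..} (\<lambda>x::real. x * ln x - x * ln p)"
    by (rule continuous_on_diff) (intro continuous_intros)
  moreover have "x * ln (x / p) = x * ln x - x * ln p" if "x \<in> {0..}" for x
    using that \<open>p > 0\<close> by (cases "x = 0") (auto simp: ln_div algebra_simps)
  ultimately show ?thesis by (subst continuous_on_cong[OF refl]) auto
qed

text \<open>A coordinate with \<open>p $ k = 0\<close> contributes the constant 0 by the conventions
  for division and \<open>ln\<close> at 0, so continuity holds on the whole orthant.\<close>

lemma continuous_on_KL_div:
  fixes p :: "real ^ 'k::finite"
  assumes "\<And>k. p $ k \<ge> 0"
  shows "continuous_on {x. \<forall>k. x $ k \<ge> 0} (\<lambda>x. KL_div x p)"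
  unfolding KL_div_def
proof (intro continuous_on_sum)
  fix k
  show "continuous_on {x. \<forall>k. x $ k \<ge> 0} (\<lambda>x. x $ k * ln (x $ k / p $ k))"
  proof (cases "p $ k = 0")
    case False
    then have "p $ k > 0" using assms[of k] by simp
    show ?thesis
      by (rule continuous_on_compose2[OF continuous_on_xlnx[OF \<open>p $ k > 0\<close>]])
        (auto intro!: continuous_intros)
  qed simp
qed

text \<open>On the compact zero set of \<open>m\<close>, \<open>F\<close> has a positive minimum;
  take \<open>\<eta>\<close> to be half of it. On the compact set where
  \<open>F \<le> \<eta>\<close> the function \<open>m\<close> is then positive, hence at least some
  \<open>\<kappa> > 0\<close>.\<close>

lemma compact_separation:
  fixes F m :: "'a::topological_space \<Rightarrow> real"
  assumes "compact T" "continuous_on T F" "continuous_on T m"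
    and "\<And>x. x \<in> T \<Longrightarrow> m x \<ge> 0" and "\<And>x. x \<in> T \<Longrightarrow> m x = 0 \<Longrightarrow> F x > 0"
  obtains \<eta> \<kappa> where "\<eta> > 0" "\<kappa> > 0" "\<And>x. x \<in> T \<Longrightarrow> m x < \<kappa> \<Longrightarrow> F x \<ge> \<eta>"
proof -
  have "\<exists>\<eta>>0. \<forall>x\<in>T. m x = 0 \<longrightarrow> F x > \<eta>"
  proof (cases "\<exists>x\<in>T. m x = 0")
    case True
    have "compact (T \<inter> m -` {0})"
      using assms by (metis closed_singleton closedin_compact continuous_closedin_preimage)
    then obtain y where y: "y \<in> T \<inter> m -` {0}" "\<And>x. x \<in> T \<inter> m -` {0} \<Longrightarrow> F y \<le> F x"
      using continuous_attains_inf[of "T \<inter> m -` {0}" F] True assms(2)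
      by (metis (no_types, lifting) continuous_on_subset inf_le1 IntI emptyE singletonI vimageI)
    then have "F y > 0" using assms(5) by auto
    with y show ?thesis by (intro exI[of _ "F y / 2"]) fastforce
  qed (auto intro: exI[of _ 1])
  then obtain \<eta> where \<eta>: "\<eta> > 0" "\<And>x. x \<in> T \<Longrightarrow> m x = 0 \<Longrightarrow> F x > \<eta>" by auto
  have "\<exists>\<kappa>>0. \<forall>x\<in>T. F x \<le> \<eta> \<longrightarrow> m x \<ge> \<kappa>"
  proof (cases "\<exists>x\<in>T. F x \<le> \<eta>")
    case True
    have "compact (T \<inter> F -` {..\<eta>})"
      using assms by (metis closed_atMost closedin_compact continuous_closedin_preimage)
    moreover have "T \<inter> F -` {..\<eta>} \<noteq> {}" using True by auto
    moreover have "continuous_on (T \<inter> F -` {..\<eta>}) m" using assms(3) continuous_on_subset by blast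
    ultimately obtain y where y: "y \<in> T \<inter> F -` {..\<eta>}" "\<And>x. x \<in> T \<inter> F -` {..\<eta>} \<Longrightarrow> m y \<le> m x"
      using continuous_attains_inf[of "T \<inter> F -` {..\<eta>}" m] by blast
    then have "m y > 0" using assms(4)[of y] \<eta>(2)[of y] by force
    with y show ?thesis by (intro exI[of _ "m y"]) auto
  qed (auto intro: exI[of _ 1])
  then obtain \<kappa> where "\<kappa> > 0" "\<And>x. x \<in> T \<Longrightarrow> F x \<le> \<eta> \<Longrightarrow> m x \<ge> \<kappa>" by auto
  with \<eta>(1) show ?thesis by (intro that[of \<eta> \<kappa>]) (meson linorder_not_le less_imp_le)+
qed

text \<open>For exact couplings other than \<open>p\<close> the divergence strictly exceeds the
  form. By compactness the gap persists, uniformly at distance at least \<open>\<epsilon>\<close>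
  from \<open>p\<close>, when the marginals are only approximately \<open>\<pi>\<close>.\<close>

lemma kron_form_le_KL_div_away:
  fixes \<pi> :: "'s::finite pmf"
  assumes c: "c < 1" "\<And>\<alpha>. \<alpha> \<in> couplings \<pi> \<Longrightarrow>
       kron_form B (\<alpha> - product_coupling \<pi>) \<le> c * KL_div \<alpha> (product_coupling \<pi>)"
    and "\<epsilon> > 0"
  obtains \<eta> \<kappa> where "\<eta> > 0" "\<kappa> > 0"
    "\<And>x. \<lbrakk>\<And>k. x $ k \<ge> 0; (\<Sum>k\<in>UNIV. x $ k) = 1; \<And>k. product_coupling \<pi> $ k = 0 \<Longrightarrow> x $ k = 0;
      \<And>i. \<bar>(\<Sum>j\<in>UNIV. x $ (i, j)) - pmf \<pi> i\<bar> \<le> \<kappa>; \<And>j. \<bar>(\<Sum>i\<in>UNIV. x $ (i, j)) - pmf \<pi> j\<bar> \<le> \<kappa>;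
      norm (x - product_coupling \<pi>) \<ge> \<epsilon>\<rbrakk>
      \<Longrightarrow> kron_form B (x - product_coupling \<pi>) \<le> KL_div x (product_coupling \<pi>) - \<eta>"
proof -
  let ?p = "product_coupling \<pi>"
  define F where "F x = KL_div x ?p - kron_form B (x - ?p)" for x
  \<comment> \<open>The total defect of the marginals: on \<open>T\<close>, its zeros are couplings
    different from \<open>p\<close>.\<close>
  define m where "m x = (\<Sum>i\<in>UNIV. \<bar>(\<Sum>j\<in>UNIV. x $ (i, j)) - pmf \<pi> i\<bar>)
      + (\<Sum>j\<in>UNIV. \<bar>(\<Sum>i\<in>UNIV. x $ (i, j)) - pmf \<pi> j\<bar>)" for x :: "real ^ ('s \<times> 's)"
  define T where "T = {x :: real ^ ('s \<times> 's). (\<forall>k. x $ k \<ge> 0) \<and> (\<Sum>k\<in>UNIV. x $ k) = 1 \<and>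
      (\<forall>k. ?p $ k = 0 \<longrightarrow> x $ k = 0) \<and> norm (x - ?p) \<ge> \<epsilon>}"
  have "closed T"
    unfolding T_def
    by (intro closed_Collect_conj closed_Collect_all closed_Collect_le closed_Collect_eq
        closed_Collect_imp continuous_intros) auto
  moreover have "bounded T"
  proof -
    have "norm x \<le> 1" if "x \<in> T" for x
    proof -
      have "norm x \<le> (\<Sum>k\<in>UNIV. \<bar>x $ k\<bar>)" by (rule norm_le_l1_cart)
      also have "\<dots> = (\<Sum>k\<in>UNIV. x $ k)" using that unfolding T_def by (intro sum.cong refl abs_of_nonneg) blast
      also have "\<dots> = 1" using that by (simp add: T_def)
      finally show ?thesis .
    qed
    then show ?thesis by (auto simp: bounded_iff)
  qed
  ultimately have "compact T" by (simp add: compact_eq_bounded_closed)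
  moreover have "continuous_on T F"
    unfolding F_def
  proof (rule continuous_on_diff)
    show "continuous_on T (\<lambda>x. KL_div x ?p)"
      by (rule continuous_on_subset[OF continuous_on_KL_div]) (auto simp: T_def product_coupling_nonneg)
    show "continuous_on T (\<lambda>x. kron_form B (x - ?p))"
      by (rule continuous_on_compose2[OF continuous_kron_form]) (auto intro!: continuous_intros)
  qed
  moreover have "continuous_on T m"
    unfolding m_def by (intro continuous_intros)
  moreover have "m x \<ge> 0" for x
    unfolding m_def by (intro add_nonneg_nonneg sum_nonneg) auto
  moreover have "F x > 0" if "x \<in> T" "m x = 0" for x
  proof -
    have "x \<in> couplings \<pi>"
      using that unfolding m_def T_def couplings_def
      by (subst (asm) add_nonneg_eq_0_iff) (auto intro!: sum_nonneg simp: sum_nonneg_eq_0_iff)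
    then have "kron_form B (x - ?p) \<le> c * KL_div x ?p" by (rule c)
    moreover have "KL_div x ?p > 0"
      using that \<open>\<epsilon> > 0\<close>
      by (intro KL_div_pos) (auto simp: T_def product_coupling_nonneg sum_product_coupling)
    then have "c * KL_div x ?p < 1 * KL_div x ?p" using c(1) by (intro mult_strict_right_mono)
    ultimately show ?thesis by (simp add: F_def)
  qed
  ultimately obtain \<eta> \<kappa> where \<eta>: "\<eta> > 0" "\<kappa> > 0" "\<And>x. x \<in> T \<Longrightarrow> m x < \<kappa> \<Longrightarrow> F x \<ge> \<eta>"
    using compact_separation[of T F m] by metis
  \<comment> \<open>There are \<open>2 * CARD('s)\<close> marginal deviations, so bounding each by
    \<open>\<kappa>'\<close> gives \<open>m x \<le> 2 / 3 * \<kappa> < \<kappa>\<close>.\<close>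
  define \<kappa>' where "\<kappa>' = \<kappa> / (3 * real CARD('s))"
  have card: "real CARD('s) > 0" by simp
  show ?thesis
  proof (rule that[of \<eta> \<kappa>'])
    show "\<eta> > 0" by fact
    show "\<kappa>' > 0" unfolding \<kappa>'_def using \<eta>(2) card by simp
    fix x :: "real ^ ('s \<times> 's)"
    assume x: "\<And>k. x $ k \<ge> 0" "(\<Sum>k\<in>UNIV. x $ k) = 1" "\<And>k. ?p $ k = 0 \<Longrightarrow> x $ k = 0"
      and mx: "\<And>i. \<bar>(\<Sum>j\<in>UNIV. x $ (i, j)) - pmf \<pi> i\<bar> \<le> \<kappa>'"
        "\<And>j. \<bar>(\<Sum>i\<in>UNIV. x $ (i, j)) - pmf \<pi> j\<bar> \<le> \<kappa>'" and "norm (x - ?p) \<ge> \<epsilon>"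
    then have "x \<in> T" by (simp add: T_def)
    moreover have "m x \<le> (\<Sum>i\<in>(UNIV::'s set). \<kappa>') + (\<Sum>i\<in>(UNIV::'s set). \<kappa>')"
      unfolding m_def by (intro add_mono sum_mono mx)
    then have "m x < \<kappa>" using \<eta>(2) card by (simp add: \<kappa>'_def)
    ultimately show "kron_form B (x - ?p) \<le> KL_div x ?p - \<eta>" using \<eta>(3) by (fastforce simp: F_def)
  qed
qed

section \<open>Overlap matrices\<close>

text \<open>For \<open>n > 0\<close>, the law of the pair of labels at a uniformly chosen
  vertex.\<close>

definition emp :: "nat \<Rightarrow> 's::finite labelling \<Rightarrow> 's labelling \<Rightarrow> real ^ ('s \<times> 's)" where
  "emp n \<sigma> \<tau> = (\<chi> k. real (joint_label_count n \<sigma> \<tau> (fst k) (snd k)) / real n)"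

lemma emp_nonneg: "emp n \<sigma> \<tau> $ k \<ge> 0"
  by (simp add: emp_def)

text \<open>The vertices are grouped by their pair of labels.\<close>

lemma prod_emp:
  fixes \<sigma> \<tau> :: "'s::finite labelling"
  shows "(\<Prod>v\<in>{1..n}. f (\<sigma> v) (\<tau> v) :: real)
     = (\<Prod>k\<in>UNIV. f (fst k) (snd k) ^ joint_label_count n \<sigma> \<tau> (fst k) (snd k))"
proof -
  have "(\<Prod>v\<in>{1..n}. f (\<sigma> v) (\<tau> v))
      = (\<Prod>k\<in>UNIV. \<Prod>v\<in>{v\<in>{1..n}. (\<sigma> v, \<tau> v) = k}. f (\<sigma> v) (\<tau> v))"
    by (rule prod.group[symmetric]) auto
  also have "\<dots> = (\<Prod>k\<in>UNIV. \<Prod>v\<in>{v\<in>{1..n}. (\<sigma> v, \<tau> v) = k}. f (fst k) (snd k))"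
    by (intro prod.cong refl) auto
  also have "\<dots> = (\<Prod>k\<in>UNIV. f (fst k) (snd k) ^ joint_label_count n \<sigma> \<tau> (fst k) (snd k))"
    by (auto simp: joint_label_count_def prod_eq_iff intro!: prod.cong arg_cong[where f=card] arg_cong2[where f="(^)"])
  finally show ?thesis .
qed

lemma sum_emp:
  assumes "n > 0"
  shows "(\<Sum>v\<in>{1..n}. f (\<sigma> v) (\<tau> v) :: real)
     = real n * (\<Sum>k\<in>UNIV. emp n \<sigma> \<tau> $ k * f (fst k) (snd k))"
proof -
  have "(\<Sum>v\<in>{1..n}. f (\<sigma> v) (\<tau> v))
      = (\<Sum>k\<in>UNIV. \<Sum>v\<in>{v\<in>{1..n}. (\<sigma> v, \<tau> v) = k}. f (\<sigma> v) (\<tau> v))"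
    by (rule sum.group[symmetric]) auto
  also have "\<dots> = (\<Sum>k\<in>UNIV. \<Sum>v\<in>{v\<in>{1..n}. (\<sigma> v, \<tau> v) = k}. f (fst k) (snd k))"
    by (intro sum.cong refl) auto
  also have "\<dots> = (\<Sum>k\<in>UNIV. real n * (emp n \<sigma> \<tau> $ k * f (fst k) (snd k)))"
    using assms by (auto simp: emp_def joint_label_count_def prod_eq_iff intro!: sum.cong)
  finally show ?thesis by (simp add: sum_distrib_left)
qed

lemma sum_emp_eq_1: "n > 0 \<Longrightarrow> (\<Sum>k\<in>UNIV. emp n \<sigma> \<tau> $ k) = 1"
  using sum_emp[of n "\<lambda>_ _. 1" \<sigma> \<tau>] by simp

lemma sum_emp_right:
  assumes "n > 0" shows "(\<Sum>j\<in>UNIV. emp n \<sigma> \<tau> $ (i, j)) = real (label_count n \<sigma> i) / real n"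
proof -
  have "(\<Sum>v\<in>{1..n}. if \<sigma> v = i then 1 else 0) = real n * (\<Sum>j\<in>UNIV. emp n \<sigma> \<tau> $ (i, j))"
    using sum_emp[OF assms, of "\<lambda>a b. if a = i then 1 else 0" \<sigma> \<tau>]
    by (simp add: sum_UNIV_prod sum.swap[of "\<lambda>a b. emp n \<sigma> \<tau> $ (a, b) * _ a b" UNIV UNIV])
       (simp add: if_distrib sum.delta cong: if_cong)
  then show ?thesis using assms by (simp add: label_count_def field_simps sum.If_cases Int_def)
qed

lemma emp_swap: "emp n \<sigma> \<tau> $ (i, j) = emp n \<tau> \<sigma> $ (j, i)"
  by (simp add: emp_def joint_label_count_def conj_commute)

lemma sum_emp_left:
  "n > 0 \<Longrightarrow> (\<Sum>i\<in>UNIV. emp n \<sigma> \<tau> $ (i, j)) = real (label_count n \<tau> j) / real n"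
  by (subst emp_swap) (rule sum_emp_right)

lemma emp_supp:
  assumes "\<And>v. v \<in> {1..n} \<Longrightarrow> pmf \<pi> (\<sigma> v) > 0 \<and> pmf \<pi> (\<tau> v) > 0" "product_coupling \<pi> $ k = 0"
  shows "emp n \<sigma> \<tau> $ k = 0"
proof -
  have "{v \<in> {1..n}. \<sigma> v = fst k \<and> \<tau> v = snd k} = {}"
    using assms by (cases k) force
  then show ?thesis by (simp add: emp_def joint_label_count_def)
qed

section \<open>Exponential moments of the overlap matrix\<close>

text \<open>The right side is the likelihood ratio of independent pairs with law
  \<open>emp n \<sigma> \<tau>\<close> against independent pairs with law \<open>p\<close>,
  evaluated at a sequence whose type is that very law.\<close>

lemma exp_KL_div_emp:
  assumes "n > 0" "\<And>v. v \<in> {1..n} \<Longrightarrow> pmf \<pi> (\<sigma> v) > 0 \<and> pmf \<pi> (\<tau> v) > 0"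
  shows "exp (real n * KL_div (emp n \<sigma> \<tau>) (product_coupling \<pi>))
    = (\<Prod>v\<in>{1..n}. emp n \<sigma> \<tau> $ (\<sigma> v, \<tau> v) / product_coupling \<pi> $ (\<sigma> v, \<tau> v))"
proof -
  let ?p = "product_coupling \<pi>" and ?a = "emp n \<sigma> \<tau>"
  let ?N = "\<lambda>k. joint_label_count n \<sigma> \<tau> (fst k) (snd k)"
  have "exp (real n * KL_div ?a ?p) = (\<Prod>k\<in>UNIV. exp (real (?N k) * ln (?a $ k / ?p $ k)))"
    unfolding KL_div_def sum_distrib_left exp_sum[OF finite_class.finite_UNIV]
    using assms(1) by (intro prod.cong refl) (simp add: emp_def)
  also have "\<dots> = (\<Prod>k\<in>UNIV. (?a $ k / ?p $ k) ^ ?N k)"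
  proof (intro prod.cong refl)
    fix k
    show "exp (real (?N k) * ln (?a $ k / ?p $ k)) = (?a $ k / ?p $ k) ^ ?N k"
    proof (cases "?N k = 0")
      case False
      then have a: "?a $ k > 0" using assms(1) by (simp add: emp_def)
      have "?p $ k \<noteq> 0"
      proof
        assume "?p $ k = 0"
        with assms(2) have "?a $ k = 0" by (rule emp_supp)
        with a show False by simp
      qed
      then have "?a $ k / ?p $ k > 0" using a product_coupling_nonneg[of \<pi> k] by simp
      then show ?thesis by (simp only: exp_of_nat_mult exp_ln)
    qed simp
  qed
  also have "\<dots> = (\<Prod>v\<in>{1..n}. ?a $ (\<sigma> v, \<tau> v) / ?p $ (\<sigma> v, \<tau> v))"
    using prod_emp[of "\<lambda>i j. ?a $ (i, j) / ?p $ (i, j)" \<sigma> \<tau> n] by simp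
  finally show ?thesis .
qed

text \<open>The method of types: each of the polynomially many possible overlap matrices \<open>a\<close> contributes
  at most the mean of the likelihood ratio of \<open>a\<close> against the product coupling, which is 1.\<close>

lemma label_avg2_exp_KL_div:
  fixes \<pi> :: "'s::finite pmf"
  assumes "n > 0"
  shows "label_avg2 n \<pi> (\<lambda>\<sigma> \<tau>. exp (real n * KL_div (emp n \<sigma> \<tau>) (product_coupling \<pi>)))
     \<le> real (n + 1) ^ CARD('s \<times> 's)"
proof -
  let ?p = "product_coupling \<pi>"
  \<comment> \<open>Every count lies in \<open>{0..n}\<close>, which bounds the number of types;
    \<open>T\<close> keeps the candidates of total mass 1.\<close>
  define A where "A = (\<lambda>m. \<chi> k. real (m k) / real n :: real ^ ('s \<times> 's)) ` (UNIV \<rightarrow>\<^sub>E {0..n})"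
  define T where "T = {a \<in> A. (\<Sum>k\<in>UNIV. a $ k) = 1}"
  have finA: "finite (UNIV \<rightarrow>\<^sub>E {0..n} :: ('s \<times> 's \<Rightarrow> nat) set)" by (intro finite_PiE) auto
  have finT: "finite T" unfolding T_def A_def using finA by auto
  have "card T \<le> card A" unfolding T_def A_def using finA by (intro card_mono) auto
  also have "\<dots> \<le> card (UNIV \<rightarrow>\<^sub>E {0..n} :: ('s \<times> 's \<Rightarrow> nat) set)"
    unfolding A_def by (intro card_image_le finA)
  also have "\<dots> = (n + 1) ^ CARD('s \<times> 's)" by (simp add: card_PiE)
  finally have cardT: "real (card T) \<le> real (n + 1) ^ CARD('s \<times> 's)"
    by (metis of_nat_le_iff of_nat_power)
  have Tnn: "a $ k \<ge> 0" if "a \<in> T" for a k using that by (auto simp: T_def A_def)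
  define f where "f a i j = a $ (i, j) / ?p $ (i, j)" for a i j
  have f_nn: "f a i j \<ge> 0" if "a \<in> T" for a i j
    unfolding f_def using Tnn[OF that] product_coupling_nonneg[of \<pi>] by (intro divide_nonneg_nonneg)
  have "label_avg2 n \<pi> (\<lambda>\<sigma> \<tau>. exp (real n * KL_div (emp n \<sigma> \<tau>) ?p))
      \<le> label_avg2 n \<pi> (\<lambda>\<sigma> \<tau>. \<Sum>a\<in>T. \<Prod>v\<in>{1..n}. f a (\<sigma> v) (\<tau> v))"
  proof (rule label_avg2_mono)
    fix \<sigma> \<tau> assume pos: "\<And>v. v \<in> {1..n} \<Longrightarrow> pmf \<pi> (\<sigma> v) > 0 \<and> pmf \<pi> (\<tau> v) > 0"
    have "joint_label_count n \<sigma> \<tau> i j \<le> card {1..n}" for i j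
      unfolding joint_label_count_def by (rule card_mono) auto
    then have "emp n \<sigma> \<tau> \<in> A"
      unfolding A_def emp_def
      by (intro image_eqI[of _ _ "\<lambda>k. joint_label_count n \<sigma> \<tau> (fst k) (snd k)"]) auto
    then have "emp n \<sigma> \<tau> \<in> T" using sum_emp_eq_1[OF assms] by (simp add: T_def)
    have "exp (real n * KL_div (emp n \<sigma> \<tau>) ?p) = (\<Prod>v\<in>{1..n}. f (emp n \<sigma> \<tau>) (\<sigma> v) (\<tau> v))"
      unfolding f_def by (rule exp_KL_div_emp[OF assms pos])
    also have "\<dots> \<le> (\<Sum>a\<in>T. \<Prod>v\<in>{1..n}. f a (\<sigma> v) (\<tau> v))"
      using f_nn by (intro member_le_sum[OF \<open>emp n \<sigma> \<tau> \<in> T\<close> _ finT] prod_nonneg) auto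
    finally show "exp (real n * KL_div (emp n \<sigma> \<tau>) ?p) \<le> \<dots>" .
  qed
  also have "\<dots> = (\<Sum>a\<in>T. (\<Sum>i\<in>UNIV. \<Sum>j\<in>UNIV. pmf \<pi> i * pmf \<pi> j * f a i j) ^ n)"
    by (simp only: label_avg_sum label_avg2_prod)
  also have "\<dots> \<le> (\<Sum>a\<in>T. 1)"
  proof (rule sum_mono)
    fix a assume a: "a \<in> T"
    \<comment> \<open>The mean under \<open>p\<close> of the ratio \<open>a / p\<close>; an
      inequality, because mass of \<open>a\<close> where \<open>p\<close> vanishes is lost.\<close>
    have "(\<Sum>i\<in>UNIV. \<Sum>j\<in>UNIV. pmf \<pi> i * pmf \<pi> j * f a i j) \<le> (\<Sum>i\<in>UNIV. \<Sum>j\<in>UNIV. a $ (i, j))"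
      using Tnn[OF a] by (intro sum_mono) (auto simp: f_def)
    also have "\<dots> = 1" using a by (simp add: T_def sum_UNIV_prod)
    finally show "(\<Sum>i\<in>UNIV. \<Sum>j\<in>UNIV. pmf \<pi> i * pmf \<pi> j * f a i j) ^ n \<le> 1"
      using f_nn[OF a] by (intro power_le_one sum_nonneg) auto
  qed
  finally show ?thesis using cardT by simp
qed

section \<open>Exponential moment away from the product coupling\<close>

definition balanced :: "real \<Rightarrow> nat \<Rightarrow> 's::finite pmf \<Rightarrow> 's labelling \<Rightarrow> bool" where
  "balanced \<kappa> n \<pi> \<sigma> \<longleftrightarrow> (\<forall>i. \<bar>real (label_count n \<sigma> i) / real n - pmf \<pi> i\<bar> \<le> \<kappa>)"

text \<open>On the event in question the form is at most the divergence minus \<open>\<eta>\<close>,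
  so the integrand is at most \<open>exp (- \<eta> * real n)\<close> times the one controlled by the
  method of types.\<close>

lemma label_avg2_exp_away:
  fixes \<pi> :: "'s::finite pmf"
  assumes c: "c < 1" "\<And>\<alpha>. \<alpha> \<in> couplings \<pi> \<Longrightarrow>
       kron_form B (\<alpha> - product_coupling \<pi>) \<le> c * KL_div \<alpha> (product_coupling \<pi>)"
    and "\<epsilon> > 0"
  obtains \<eta> \<kappa> where "\<eta> > 0" "\<kappa> > 0"
    "\<And>n. n > 0 \<Longrightarrow> label_avg2 n \<pi> (\<lambda>\<sigma> \<tau>.
       if balanced \<kappa> n \<pi> \<sigma> \<and> balanced \<kappa> n \<pi> \<tau> \<and> norm (emp n \<sigma> \<tau> - product_coupling \<pi>) \<ge> \<epsilon>
       then exp (real n * kron_form B (emp n \<sigma> \<tau> - product_coupling \<pi>)) else 0)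
     \<le> exp (- \<eta> * real n) * real (n + 1) ^ CARD('s \<times> 's)"
proof -
  let ?p = "product_coupling \<pi>"
  obtain \<eta> \<kappa> where \<eta>: "\<eta> > 0" "\<kappa> > 0" and gap:
    "\<And>x. \<lbrakk>\<And>k. x $ k \<ge> 0; (\<Sum>k\<in>UNIV. x $ k) = 1; \<And>k. ?p $ k = 0 \<Longrightarrow> x $ k = 0;
      \<And>i. \<bar>(\<Sum>j\<in>UNIV. x $ (i, j)) - pmf \<pi> i\<bar> \<le> \<kappa>; \<And>j. \<bar>(\<Sum>i\<in>UNIV. x $ (i, j)) - pmf \<pi> j\<bar> \<le> \<kappa>;
      norm (x - ?p) \<ge> \<epsilon>\<rbrakk> \<Longrightarrow> kron_form B (x - ?p) \<le> KL_div x ?p - \<eta>"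
    using kron_form_le_KL_div_away[OF c \<open>\<epsilon> > 0\<close>] by metis
  show ?thesis
  proof (rule that[OF \<eta>])
    fix n :: nat assume n: "n > 0"
    have "label_avg2 n \<pi> (\<lambda>\<sigma> \<tau>.
       if balanced \<kappa> n \<pi> \<sigma> \<and> balanced \<kappa> n \<pi> \<tau> \<and> norm (emp n \<sigma> \<tau> - ?p) \<ge> \<epsilon>
       then exp (real n * kron_form B (emp n \<sigma> \<tau> - ?p)) else 0)
      \<le> label_avg2 n \<pi> (\<lambda>\<sigma> \<tau>. exp (- \<eta> * real n) * exp (real n * KL_div (emp n \<sigma> \<tau>) ?p))"
    proof (rule label_avg2_mono)
      fix \<sigma> \<tau> assume pos: "\<And>v. v \<in> {1..n} \<Longrightarrow> pmf \<pi> (\<sigma> v) > 0 \<and> pmf \<pi> (\<tau> v) > 0"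
      show "(if balanced \<kappa> n \<pi> \<sigma> \<and> balanced \<kappa> n \<pi> \<tau> \<and> norm (emp n \<sigma> \<tau> - ?p) \<ge> \<epsilon>
         then exp (real n * kron_form B (emp n \<sigma> \<tau> - ?p)) else 0)
        \<le> exp (- \<eta> * real n) * exp (real n * KL_div (emp n \<sigma> \<tau>) ?p)"
      proof (cases "balanced \<kappa> n \<pi> \<sigma> \<and> balanced \<kappa> n \<pi> \<tau> \<and> norm (emp n \<sigma> \<tau> - ?p) \<ge> \<epsilon>")
        case True
        then have "kron_form B (emp n \<sigma> \<tau> - ?p) \<le> KL_div (emp n \<sigma> \<tau>) ?p - \<eta>"
          using emp_supp[OF pos]
          by (intro gap emp_nonneg sum_emp_eq_1 n) (auto simp: balanced_def sum_emp_left[OF n] sum_emp_right[OF n])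
        then have "real n * kron_form B (emp n \<sigma> \<tau> - ?p) \<le> real n * (KL_div (emp n \<sigma> \<tau>) ?p - \<eta>)"
          by (intro mult_left_mono) auto
        then show ?thesis unfolding if_P[OF True] by (simp add: exp_add[symmetric] algebra_simps)
      next
        case False
        then show ?thesis unfolding if_not_P[OF False] by simp
      qed
    qed
    also have "\<dots> = exp (- \<eta> * real n) * label_avg2 n \<pi> (\<lambda>\<sigma> \<tau>. exp (real n * KL_div (emp n \<sigma> \<tau>) ?p))"
      by (rule label_avg2_cmult)
    also have "\<dots> \<le> exp (- \<eta> * real n) * real (n + 1) ^ CARD('s \<times> 's)"
      by (intro mult_left_mono label_avg2_exp_KL_div n) auto
    finally show "label_avg2 n \<pi> (\<lambda>\<sigma> \<tau>.
       if balanced \<kappa> n \<pi> \<sigma> \<and> balanced \<kappa> n \<pi> \<tau> \<and> norm (emp n \<sigma> \<tau> - ?p) \<ge> \<epsilon>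
       then exp (real n * kron_form B (emp n \<sigma> \<tau> - ?p)) else 0) \<le> \<dots>" .
  qed
qed

section \<open>Bounded exponential moment near the product coupling\<close>

lemma exp_quadratic_upper:
  fixes w :: real
  assumes "\<bar>w\<bar> \<le> \<omega>"
  shows "exp w \<le> 1 + w + exp \<omega> / 2 * w\<^sup>2"
proof -
  obtain t where t: "\<bar>t\<bar> \<le> \<bar>w\<bar>" "exp w = (\<Sum>m<2. w ^ m / fact m) + exp t / fact 2 * w ^ 2"
    using Maclaurin_exp_le by blast
  have "exp t / 2 * w\<^sup>2 \<le> exp \<omega> / 2 * w\<^sup>2"
    using t(1) assms by (intro mult_right_mono) auto
  with t(2) show ?thesis by (simp add: numeral_2_eq_2)
qed

text \<open>The set \<open>D\<close> is enlarged to a box, over which the sum factorises into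
  one-dimensional sums. Each is dominated by two geometric series, one for each sign, because
  \<open>\<bar>y\<bar> \<le> y\<^sup>2\<close> for integers.\<close>

lemma discrete_gaussian_sum_bounded:
  assumes "\<beta> > 0"
  shows "\<exists>C. \<forall>D :: ('k::finite \<Rightarrow> int) set. finite D \<longrightarrow>
     (\<Sum>z\<in>D. exp (- \<beta> * (\<Sum>k\<in>UNIV. (real_of_int (z k))\<^sup>2))) \<le> C"
proof -
  define C1 where "C1 = 2 / (1 - exp (- \<beta>))"
  have one: "(\<Sum>y\<in>{- int N..int N}. exp (- \<beta> * (real_of_int y)\<^sup>2)) \<le> C1" for N
  proof -
    have "(\<Sum>y\<in>{- int N..int N}. exp (- \<beta> * (real_of_int y)\<^sup>2))
        \<le> (\<Sum>y\<in>{- int N..int N}. exp (- \<beta>) ^ nat \<bar>y\<bar>)"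
    proof (rule sum_mono)
      fix y :: int
      have "\<bar>y\<bar> * 1 \<le> \<bar>y\<bar> * \<bar>y\<bar>" 
      proof (cases "y = 0")
        case False
        then show ?thesis by (intro mult_left_mono) auto
      qed simp
      then have "\<bar>y\<bar> \<le> y\<^sup>2" by (simp add: power2_eq_square abs_mult_self_eq)
      then have "real_of_int \<bar>y\<bar> \<le> (real_of_int y)\<^sup>2" by (metis of_int_le_iff of_int_power)
      then have "- \<beta> * (real_of_int y)\<^sup>2 \<le> real (nat \<bar>y\<bar>) * (- \<beta>)"
        using assms by simp
      then show "exp (- \<beta> * (real_of_int y)\<^sup>2) \<le> exp (- \<beta>) ^ nat \<bar>y\<bar>"
        unfolding exp_of_nat_mult[symmetric] by simp
    qed
    also have "\<dots> \<le> (\<Sum>y\<in>int ` {..N} \<union> (\<lambda>m. - int m) ` {..N}. exp (- \<beta>) ^ nat \<bar>y\<bar>)"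
    proof (rule sum_mono2)
      show "{- int N..int N} \<subseteq> int ` {..N} \<union> (\<lambda>m. - int m) ` {..N}"
      proof
        fix y assume y: "y \<in> {- int N..int N}"
        then show "y \<in> int ` {..N} \<union> (\<lambda>m. - int m) ` {..N}"
          by (cases "y \<ge> 0") (auto intro: image_eqI[of _ _ "nat y"] image_eqI[of _ _ "nat (- y)"])
      qed
    qed auto
    also have "\<dots> \<le> (\<Sum>y\<in>int ` {..N}. exp (- \<beta>) ^ nat \<bar>y\<bar>) + (\<Sum>y\<in>(\<lambda>m. - int m) ` {..N}. exp (- \<beta>) ^ nat \<bar>y\<bar>)"
      by (subst sum.union_inter[symmetric]) (auto intro!: sum_nonneg)
    also have "\<dots> = (\<Sum>m\<le>N. exp (- \<beta>) ^ m) + (\<Sum>m\<le>N. exp (- \<beta>) ^ m)"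
      by (subst (1 2) sum.reindex) (auto simp: inj_on_def)
    also have "(\<Sum>m\<le>N. exp (- \<beta>) ^ m) \<le> 1 / (1 - exp (- \<beta>))"
      using assms sum_le_suminf[of "\<lambda>m. exp (- \<beta>) ^ m" "{..N}"]
      by (simp add: suminf_geometric summable_geometric)
    finally show ?thesis by (simp add: C1_def)
  qed
  have "(\<Sum>z\<in>D. exp (- \<beta> * (\<Sum>k\<in>UNIV. (real_of_int (z k))\<^sup>2))) \<le> C1 ^ CARD('k)"
    if D: "finite D" for D :: "('k \<Rightarrow> int) set"
  proof -
    \<comment> \<open>A crude bound on all entries of all members of \<open>D\<close>.\<close>
    define N where "N = (\<Sum>z\<in>D. \<Sum>k\<in>UNIV. nat \<bar>z k\<bar>)"
    define P where "P = PiE (UNIV :: 'k set) (\<lambda>_. {- int N..int N})"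
    have "D \<subseteq> P"
    proof
      fix z assume "z \<in> D"
      have "nat \<bar>z k\<bar> \<le> N" for k
      proof -
        have "nat \<bar>z k\<bar> \<le> (\<Sum>k\<in>UNIV. nat \<bar>z k\<bar>)" by (intro member_le_sum) auto
        also have "\<dots> \<le> N"
          unfolding N_def using \<open>z \<in> D\<close> D by (intro member_le_sum[of z D "\<lambda>z. \<Sum>k\<in>UNIV. nat \<bar>z k\<bar>"]) auto
        finally show ?thesis .
      qed
      then have "\<bar>z k\<bar> \<le> int N" for k by (metis nat_le_iff)
      then show "z \<in> P" by (auto simp: P_def abs_le_iff minus_le_iff)
    qed
    then have "(\<Sum>z\<in>D. exp (- \<beta> * (\<Sum>k\<in>UNIV. (real_of_int (z k))\<^sup>2)))
      \<le> (\<Sum>z\<in>P. exp (- \<beta> * (\<Sum>k\<in>UNIV. (real_of_int (z k))\<^sup>2)))"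
      by (intro sum_mono2) (auto simp: P_def intro: finite_PiE)
    also have "\<dots> = (\<Sum>z\<in>P. \<Prod>k\<in>UNIV. exp (- \<beta> * (real_of_int (z k))\<^sup>2))"
      by (simp add: sum_distrib_left exp_sum[symmetric])
    also have "\<dots> = (\<Prod>k\<in>(UNIV::'k set). \<Sum>y\<in>{- int N..int N}. exp (- \<beta> * (real_of_int y)\<^sup>2))"
      unfolding P_def by (rule prod_sum_PiE[symmetric]) auto
    also have "\<dots> \<le> (\<Prod>k\<in>(UNIV::'k set). C1)"
      by (intro prod_mono conjI one sum_nonneg) auto
    finally show ?thesis by simp
  qed
  then show ?thesis by blast
qed

text \<open>Normalisations for the linearisation below. They also hold for \<open>p = 0\<close>,
  where both sides are 0.\<close>

lemma sqrt_rescale: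
  fixes c n p x z :: real
  assumes "c \<ge> 0" "n > 0" "p \<ge> 0"
  shows "sqrt (c * n) * x / sqrt p * sqrt (c / (n * p)) = c * x / p"
    and "z * (sqrt (c * n) * x / sqrt p) = n * (x * (z * sqrt (c / (n * p))))"
proof -
  obtain a b d where "a \<ge> 0" "c = a * a" "b > 0" "n = b * b" "d \<ge> 0" "p = d * d"
    using assms that[of "sqrt c" "sqrt n" "sqrt p"] by simp
  then show "sqrt (c * n) * x / sqrt p * sqrt (c / (n * p)) = c * x / p"
    and "z * (sqrt (c * n) * x / sqrt p) = n * (x * (z * sqrt (c / (n * p))))"
    by (simp_all add: real_sqrt_mult real_sqrt_divide field_simps)
qed

text \<open>A discrete Hubbard--Stratonovich linearisation: \<open>exp (Y\<^sup>2 / 2)\<close> is at most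
  \<open>exp (1 / 8 + z * Y - z\<^sup>2 / 2)\<close> for \<open>z = round Y\<close>, and for a fixed integer vector \<open>z\<close> the
  exponential is a product over the vertices.\<close>

lemma label_avg2_exp_near:
  fixes \<pi> :: "'s::finite pmf"
  assumes c: "0 \<le> c" "c < 1" "\<And>\<alpha>. \<alpha> \<in> couplings \<pi> \<Longrightarrow>
       kron_form B (\<alpha> - product_coupling \<pi>) \<le> c * KL_div \<alpha> (product_coupling \<pi>)"
    and B: "transpose B = B" "\<And>i. (\<Sum>j\<in>UNIV. B $ i $ j * pmf \<pi> j) = 0"
  obtains \<epsilon> C where "\<epsilon> > 0"
    "eventually (\<lambda>n. label_avg2 n \<pi> (\<lambda>\<sigma> \<tau>. if norm (emp n \<sigma> \<tau> - product_coupling \<pi>) < \<epsilon>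
       then exp (real n * kron_form B (emp n \<sigma> \<tau> - product_coupling \<pi>)) else 0) \<le> C) sequentially"
proof -
  let ?p = "product_coupling \<pi>"
  note p_nn = product_coupling_nonneg[of \<pi>]
  \<comment> \<open>The slack in \<open>c < 1\<close> leaves room for
    \<open>(1 + \<eta>) * c < 1\<close>. The choice of \<open>\<omega>\<close> makes the Taylor
    constant \<open>exp \<omega> / 2\<close> equal to \<open>(1 + \<eta>) / 2\<close>, and
    \<open>\<beta>\<close> is the decay rate that remains in the sum over \<open>z\<close>.\<close>
  define \<eta> where "\<eta> = (1 - c) / 2"
  define \<omega> where "\<omega> = ln (1 + \<eta>)"
  define \<beta> where "\<beta> = (1 - (1 + \<eta>) * c) / 2"
  have \<eta>: "\<eta> > 0" using c by (simp add: \<eta>_def)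
  have \<omega>: "\<omega> > 0" "exp \<omega> = 1 + \<eta>" using \<eta> by (simp_all add: \<omega>_def)
  have "\<eta> * c \<le> \<eta> * 1" using \<eta> c by (intro mult_left_mono) auto
  then have \<beta>: "\<beta> > 0" using c by (simp add: \<beta>_def \<eta>_def field_simps)
  obtain C1 where C1: "\<And>D :: ('s \<times> 's \<Rightarrow> int) set. finite D \<Longrightarrow>
     (\<Sum>z\<in>D. exp (- \<beta> * (\<Sum>k\<in>UNIV. (real_of_int (z k))\<^sup>2))) \<le> C1"
    using discrete_gaussian_sum_bounded[OF \<beta>] by blast
  \<comment> \<open>The bound \<open>\<omega>\<close> on the tilt \<open>w\<close> is split in two:
    half for the distance of \<open>emp\<close> from \<open>p\<close>, controlled by
    \<open>\<epsilon>\<close>, and half for the rounding error, controlled by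
    \<open>n\<close>.\<close>
  have "eventually (\<lambda>\<epsilon>. \<epsilon> > 0 \<and> (\<forall>k. c * \<epsilon> / ?p $ k < \<omega> / 2)) (at_right (0::real))"
  proof (intro eventually_conj eventually_all_finite)
    fix k
    have "((\<lambda>\<epsilon>. c * \<epsilon> * inverse (?p $ k)) \<longlongrightarrow> c * 0 * inverse (?p $ k)) (at_right 0)"
      by (intro tendsto_intros)
    then have "eventually (\<lambda>\<epsilon>. c * \<epsilon> * inverse (?p $ k) < \<omega> / 2) (at_right 0)"
      by (rule order_tendstoD(2)) (use \<omega>(1) in simp)
    then show "eventually (\<lambda>\<epsilon>. c * \<epsilon> / ?p $ k < \<omega> / 2) (at_right 0)"
      by (simp only: divide_inverse)
  qed (simp add: eventually_at_right_less)
  then have "\<exists>\<epsilon>. \<epsilon> > 0 \<and> (\<forall>k. c * \<epsilon> / ?p $ k < \<omega> / 2)"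
    by (rule eventually_happens'[rotated]) simp
  then obtain \<epsilon> where \<epsilon>: "\<epsilon> > 0" "\<And>k. c * \<epsilon> / ?p $ k < \<omega> / 2" by blast
  have "eventually (\<lambda>n. n > 0 \<and> (\<forall>k. sqrt (c / (real n * ?p $ k)) / 2 < \<omega> / 2)) sequentially"
  proof (intro eventually_conj eventually_all_finite)
    fix k
    have "((\<lambda>n. sqrt (c / ?p $ k * (1 / real n)) / 2) \<longlonglongrightarrow> sqrt (c / ?p $ k * 0) / 2)"
      by (intro tendsto_intros lim_1_over_n) auto
    then have "eventually (\<lambda>n. sqrt (c / ?p $ k * (1 / real n)) / 2 < \<omega> / 2) sequentially"
      by (rule order_tendstoD(2)) (use \<omega>(1) in simp)
    moreover have "c / ?p $ k * (1 / real n) = c / (real n * ?p $ k)" for n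
      by (simp add: mult.commute)
    ultimately show "eventually (\<lambda>n. sqrt (c / (real n * ?p $ k)) / 2 < \<omega> / 2) sequentially"
      by (simp only:)
  qed (simp add: eventually_gt_at_top)
  then have "eventually (\<lambda>n. label_avg2 n \<pi> (\<lambda>\<sigma> \<tau>. if norm (emp n \<sigma> \<tau> - ?p) < \<epsilon>
       then exp (real n * kron_form B (emp n \<sigma> \<tau> - ?p)) else 0)
       \<le> exp (real CARD('s \<times> 's) / 8) * C1) sequentially"
  proof eventually_elim
    case (elim n)
    then have n: "n > 0" and n': "\<And>k. sqrt (c / (real n * ?p $ k)) / 2 < \<omega> / 2" by auto
    \<comment> \<open>Chosen so that
      \<open>real n * (c / 2 * chi2 p (emp n \<sigma> \<tau> - p))\<close> is the sum of the
      \<open>(Y \<sigma> \<tau> k)\<^sup>2 / 2\<close>. For fixed \<open>z\<close>,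
      \<open>w z\<close> is the corresponding tilt of a label pair and \<open>m z\<close> its mean
      under \<open>p\<close>.\<close>
    define Y where "Y \<sigma> \<tau> k = sqrt (c * real n) * (emp n \<sigma> \<tau> - ?p) $ k / sqrt (?p $ k)" for \<sigma> \<tau> k
    define Z where "Z \<sigma> \<tau> k = round (Y \<sigma> \<tau> k)" for \<sigma> \<tau> k
    define w where "w z k = real_of_int (z k) * sqrt (c / (real n * ?p $ k))" for z k
    define m where "m z = (\<Sum>k\<in>UNIV. ?p $ k * w z k)" for z
    define g where "g z i j = exp (w z (i, j) - m z)" for z i j
    \<comment> \<open>Only rounded vectors that occur are collected, so \<open>D\<close> is finite;
      the bound on \<open>w\<close> is kept for the Taylor estimate.\<close>
    define D where "D = {z \<in> (\<lambda>(\<sigma>, \<tau>). Z \<sigma> \<tau>) ` (labellings n \<times> labellings n). \<forall>k. \<bar>w z k\<bar> \<le> \<omega>}"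
    have finD: "finite D" unfolding D_def by auto
    have Yw: "Y \<sigma> \<tau> k * sqrt (c / (real n * ?p $ k)) = c * (emp n \<sigma> \<tau> - ?p) $ k / ?p $ k" for \<sigma> \<tau> k
      using n c(1) p_nn unfolding Y_def by (intro sqrt_rescale(1)) auto
    have zY: "real_of_int (z k) * Y \<sigma> \<tau> k = real n * ((emp n \<sigma> \<tau> - ?p) $ k * w z k)" for z \<sigma> \<tau> k
      using n c(1) p_nn unfolding Y_def w_def by (intro sqrt_rescale(2)) auto
    have "label_avg2 n \<pi> (\<lambda>\<sigma> \<tau>. if norm (emp n \<sigma> \<tau> - ?p) < \<epsilon>
         then exp (real n * kron_form B (emp n \<sigma> \<tau> - ?p)) else 0)
      \<le> label_avg2 n \<pi> (\<lambda>\<sigma> \<tau>. exp (real CARD('s \<times> 's) / 8) *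
           (\<Sum>z\<in>D. exp (- (\<Sum>k\<in>UNIV. (real_of_int (z k))\<^sup>2) / 2) * (\<Prod>v\<in>{1..n}. g z (\<sigma> v) (\<tau> v))))"
    proof (rule label_avg2_mono)
      fix \<sigma> \<tau> :: "'s labelling"
      assume lab: "\<sigma> \<in> labellings n" "\<tau> \<in> labellings n"
        and pos: "\<And>v. v \<in> {1..n} \<Longrightarrow> pmf \<pi> (\<sigma> v) > 0 \<and> pmf \<pi> (\<tau> v) > 0"
      let ?X = "emp n \<sigma> \<tau> - ?p" and ?z = "Z \<sigma> \<tau>"
      let ?t = "\<lambda>z. exp (- (\<Sum>k\<in>UNIV. (real_of_int (z k))\<^sup>2) / 2) * (\<Prod>v\<in>{1..n}. g z (\<sigma> v) (\<tau> v))"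
      have t_nn: "?t z \<ge> 0" for z
        unfolding g_def by (intro mult_nonneg_nonneg prod_nonneg) auto
      show "(if norm ?X < \<epsilon> then exp (real n * kron_form B ?X) else 0)
        \<le> exp (real CARD('s \<times> 's) / 8) * (\<Sum>z\<in>D. ?t z)"
      proof (cases "norm ?X < \<epsilon>")
        case False
        then show ?thesis using t_nn by (simp add: sum_nonneg)
      next
        case True
        have rnd: "\<bar>real_of_int (?z k) - Y \<sigma> \<tau> k\<bar> \<le> 1 / 2" for k
          unfolding Z_def by (rule of_int_round_abs_le)
        have "\<bar>w ?z k\<bar> \<le> \<omega>" for k
        proof -
          have "\<bar>real_of_int (?z k)\<bar> \<le> \<bar>Y \<sigma> \<tau> k\<bar> + 1 / 2" using rnd[of k] by linarith
          then have "\<bar>w ?z k\<bar> \<le> (\<bar>Y \<sigma> \<tau> k\<bar> + 1 / 2) * sqrt (c / (real n * ?p $ k))"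
            unfolding w_def abs_mult using c(1) p_nn[of k] by (simp add: mult_right_mono)
          also have "\<dots> = \<bar>Y \<sigma> \<tau> k * sqrt (c / (real n * ?p $ k))\<bar> + sqrt (c / (real n * ?p $ k)) / 2"
            using c(1) p_nn[of k] by (simp add: abs_mult algebra_simps)
          also have "\<bar>Y \<sigma> \<tau> k * sqrt (c / (real n * ?p $ k))\<bar> = c * \<bar>?X $ k\<bar> / ?p $ k"
            unfolding Yw using c(1) p_nn[of k] by (simp add: abs_mult)
          also have "\<dots> \<le> c * \<epsilon> / ?p $ k"
            using True component_le_norm_cart[of ?X k] c(1) p_nn[of k]
            by (intro divide_right_mono mult_left_mono) auto
          finally show ?thesis using \<epsilon>(2)[of k] n'[of k] by linarith
        qed
        then have zD: "?z \<in> D" using lab by (auto simp: D_def)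
        have "(\<Sum>k\<in>UNIV. ?X $ k) = 0"
          by (simp add: sum_subtractf sum_emp_eq_1[OF n] sum_product_coupling)
        moreover have "?X $ k = 0" if "?p $ k = 0" for k
          using emp_supp[OF pos that] that by simp
        ultimately have "kron_form B ?X \<le> c / 2 * chi2 ?p ?X"
          by (intro kron_form_le_chi2[OF c(1,3) B])
        then have "real n * kron_form B ?X \<le> real n * (c / 2 * chi2 ?p ?X)"
          by (intro mult_left_mono) auto
        also have "\<dots> = (\<Sum>k\<in>UNIV. (Y \<sigma> \<tau> k)\<^sup>2 / 2)"
          unfolding chi2_def sum_distrib_left
          using c(1) p_nn by (intro sum.cong refl) (simp add: Y_def power_mult_distrib power_divide mult_ac)
        also have "\<dots> \<le> (\<Sum>k\<in>UNIV. 1 / 8 + (real n * (?X $ k * w ?z k) - (real_of_int (?z k))\<^sup>2 / 2))"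
        proof (rule sum_mono)
          fix k
          have "(real_of_int (?z k) - Y \<sigma> \<tau> k)\<^sup>2 \<le> (1 / 2)\<^sup>2"
            using rnd[of k] by (intro abs_le_square_iff[THEN iffD1]) simp
          then show "(Y \<sigma> \<tau> k)\<^sup>2 / 2 \<le> 1 / 8 + (real n * (?X $ k * w ?z k) - (real_of_int (?z k))\<^sup>2 / 2)"
            unfolding zY[symmetric] by (simp add: power2_eq_square algebra_simps)
        qed
        also have "\<dots> = real CARD('s \<times> 's) / 8 + (real n * (\<Sum>k\<in>UNIV. ?X $ k * w ?z k)
            - (\<Sum>k\<in>UNIV. (real_of_int (?z k))\<^sup>2) / 2)"
          unfolding sum.distrib sum_subtractf sum_distrib_left[symmetric] sum_divide_distrib[symmetric] by simp
        \<comment> \<open>For fixed \<open>z\<close> the exponent is linear in \<open>emp\<close>,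
          hence a sum over vertices.\<close>
        also have "real n * (\<Sum>k\<in>UNIV. ?X $ k * w ?z k)
            = (\<Sum>v\<in>{1..n}. w ?z (\<sigma> v, \<tau> v) - m ?z)"
          unfolding sum_emp[OF n, of "\<lambda>i j. w ?z (i, j) - m ?z" \<sigma> \<tau>]
          by (simp add: right_diff_distrib left_diff_distrib sum_subtractf sum_distrib_right[symmetric]
              sum_emp_eq_1[OF n] m_def del: sum_subtractf_nat)
        finally have "exp (real n * kron_form B ?X)
            \<le> exp (real CARD('s \<times> 's) / 8 + ((\<Sum>v\<in>{1..n}. w ?z (\<sigma> v, \<tau> v) - m ?z)
            - (\<Sum>k\<in>UNIV. (real_of_int (?z k))\<^sup>2) / 2))" by simp
        also have "\<dots> = exp (real CARD('s \<times> 's) / 8) * ?t ?z"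
          unfolding g_def exp_sum[OF finite_atLeastAtMost, symmetric] exp_add[symmetric] by simp
        also have "\<dots> \<le> exp (real CARD('s \<times> 's) / 8) * (\<Sum>z\<in>D. ?t z)"
          using t_nn by (intro mult_left_mono member_le_sum[OF zD _ finD]) auto
        finally show ?thesis using True by simp
      qed
    qed
    also have "\<dots> = exp (real CARD('s \<times> 's) / 8) * (\<Sum>z\<in>D. exp (- (\<Sum>k\<in>UNIV. (real_of_int (z k))\<^sup>2) / 2)
        * (\<Sum>i\<in>UNIV. \<Sum>j\<in>UNIV. pmf \<pi> i * pmf \<pi> j * g z i j) ^ n)"
      by (simp only: label_avg_cmult label_avg_sum label_avg2_prod)
    also have "\<dots> \<le> exp (real CARD('s \<times> 's) / 8) * (\<Sum>z\<in>D. exp (- \<beta> * (\<Sum>k\<in>UNIV. (real_of_int (z k))\<^sup>2)))"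
    proof (intro mult_left_mono sum_mono)
      fix z assume "z \<in> D"
      then have wz: "\<bar>w z k\<bar> \<le> \<omega>" for k unfolding D_def by blast
      let ?s = "\<Sum>k\<in>UNIV. (real_of_int (z k))\<^sup>2" and ?q = "\<Sum>k\<in>UNIV. ?p $ k * (w z k)\<^sup>2"
      have "(\<Sum>i\<in>UNIV. \<Sum>j\<in>UNIV. pmf \<pi> i * pmf \<pi> j * g z i j) = exp (- m z) * (\<Sum>k\<in>UNIV. ?p $ k * exp (w z k))"
        by (simp add: g_def exp_diff exp_minus sum_UNIV_prod sum_distrib_left field_simps)
      also have "\<dots> \<le> exp (- m z) * (\<Sum>k\<in>UNIV. ?p $ k * (1 + w z k + (1 + \<eta>) / 2 * (w z k)\<^sup>2))"
        using exp_quadratic_upper[OF wz] p_nn unfolding \<omega>(2) by (intro mult_left_mono sum_mono) auto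
      \<comment> \<open>The linear terms add up to \<open>m z\<close>, which the factor
        \<open>exp (- m z)\<close> cancels.\<close>
      also have "(\<Sum>k\<in>UNIV. ?p $ k * (1 + w z k + (1 + \<eta>) / 2 * (w z k)\<^sup>2)) = 1 + (m z + (1 + \<eta>) / 2 * ?q)"
        by (simp add: distrib_left sum.distrib sum_product_coupling m_def sum_distrib_left mult_ac)
      also have "\<dots> \<le> exp (m z + (1 + \<eta>) / 2 * ?q)" by (rule exp_ge_add_one_self)
      finally have "(\<Sum>i\<in>UNIV. \<Sum>j\<in>UNIV. pmf \<pi> i * pmf \<pi> j * g z i j) \<le> exp ((1 + \<eta>) / 2 * ?q)"
        by (simp add: mult_exp_exp)
      then have "(\<Sum>i\<in>UNIV. \<Sum>j\<in>UNIV. pmf \<pi> i * pmf \<pi> j * g z i j) ^ n \<le> exp ((1 + \<eta>) / 2 * ?q) ^ n"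
        by (intro power_mono sum_nonneg) (auto simp: g_def)
      also have "\<dots> = exp ((1 + \<eta>) / 2 * (real n * ?q))"
        by (simp add: exp_of_nat_mult[symmetric] mult_ac)
      \<comment> \<open>Termwise an equality, except where \<open>p\<close> vanishes and the left
        term is 0.\<close>
      also have "real n * ?q \<le> c * ?s"
        unfolding sum_distrib_left
      proof (rule sum_mono)
        fix k
        show "real n * (?p $ k * (w z k)\<^sup>2) \<le> c * (real_of_int (z k))\<^sup>2"
          using n c(1) p_nn[of k] by (cases "?p $ k = 0") (auto simp: w_def power_mult_distrib)
      qed
      finally have "(\<Sum>i\<in>UNIV. \<Sum>j\<in>UNIV. pmf \<pi> i * pmf \<pi> j * g z i j) ^ n \<le> exp ((1 + \<eta>) / 2 * (c * ?s))"
        using \<eta> by simp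
      then have "exp (- ?s / 2) * (\<Sum>i\<in>UNIV. \<Sum>j\<in>UNIV. pmf \<pi> i * pmf \<pi> j * g z i j) ^ n
          \<le> exp (- ?s / 2) * exp ((1 + \<eta>) / 2 * (c * ?s))" by (intro mult_left_mono) auto
      also have "\<dots> = exp (- \<beta> * ?s)"
        by (simp add: exp_add[symmetric] \<beta>_def field_simps)
      finally show "exp (- ?s / 2) * (\<Sum>i\<in>UNIV. \<Sum>j\<in>UNIV. pmf \<pi> i * pmf \<pi> j * g z i j) ^ n \<le> exp (- \<beta> * ?s)" .
    qed simp
    also have "\<dots> \<le> exp (real CARD('s \<times> 's) / 8) * C1"
      by (intro mult_left_mono C1 finD) auto
    finally show ?case .
  qed
  with \<epsilon>(1) show ?thesis by (rule that)
qed

section \<open>Concentration of the label counts\<close>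

text \<open>Chernoff's bound with parameter \<open>\<kappa> / 2\<close> and a union bound over the
  label \<open>i\<close> and the sign \<open>s\<close> of the deviation. The exponential moment of a
  centred indicator is at most \<open>exp (\<kappa>\<^sup>2 / 4)\<close>, half of the exponent
  gained from the deviation.\<close>

lemma label_avg_not_balanced:
  fixes \<pi> :: "'s::finite pmf"
  assumes "0 < \<kappa>" "\<kappa> \<le> 1" "n > 0"
  shows "label_avg n \<pi> (\<lambda>\<sigma>. of_bool (\<not> balanced \<kappa> n \<pi> \<sigma>)) \<le> 2 * real CARD('s) * exp (- (\<kappa>\<^sup>2 / 4) * real n)"
proof -
  define y where "y i l = of_bool (l = i) - pmf \<pi> i" for i l :: 's
  have label_sum: "(\<Sum>v\<in>{1..n}. y i (\<sigma> v)) = real (label_count n \<sigma> i) - real n * pmf \<pi> i" for i \<sigma>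
    by (simp add: y_def sum_subtractf label_count_def of_bool_def sum.If_cases Int_def)
  have "label_avg n \<pi> (\<lambda>\<sigma>. of_bool (\<not> balanced \<kappa> n \<pi> \<sigma>))
    \<le> label_avg n \<pi> (\<lambda>\<sigma>. \<Sum>i\<in>UNIV. \<Sum>s\<in>{1, -1}. exp (- (\<kappa>\<^sup>2 / 2) * real n) * (\<Prod>v\<in>{1..n}. exp (\<kappa> / 2 * s * y i (\<sigma> v))))"
  proof (rule label_avg_mono)
    fix \<sigma>
    let ?e = "\<lambda>i s. exp (- (\<kappa>\<^sup>2 / 2) * real n) * (\<Prod>v\<in>{1..n}. exp (\<kappa> / 2 * s * y i (\<sigma> v)))"
    have e_nn: "?e i s \<ge> 0" for i s by (intro mult_nonneg_nonneg prod_nonneg) auto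
    have e: "?e i s = exp (\<kappa> / 2 * (s * (real (label_count n \<sigma> i) - real n * pmf \<pi> i) - \<kappa> * real n))" for i s
      unfolding label_sum[symmetric]
      by (simp add: exp_sum[symmetric] exp_add[symmetric] sum_distrib_left power2_eq_square algebra_simps)
    show "of_bool (\<not> balanced \<kappa> n \<pi> \<sigma>) \<le> (\<Sum>i\<in>UNIV. \<Sum>s\<in>{1, -1}. ?e i s)"
    proof (cases "balanced \<kappa> n \<pi> \<sigma>")
      case True
      have "0 \<le> (\<Sum>i\<in>UNIV. \<Sum>s\<in>{1, -1}. ?e i s)" by (intro sum_nonneg e_nn)
      then show ?thesis by (simp only: True not_True_eq_False of_bool_eq)
    next
      case False
      then obtain i where i: "\<bar>real (label_count n \<sigma> i) / real n - pmf \<pi> i\<bar> > \<kappa>"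
        by (auto simp: balanced_def not_le)
      define s :: real where "s = (if real (label_count n \<sigma> i) / real n - pmf \<pi> i > 0 then 1 else -1)"
      have "s * (real (label_count n \<sigma> i) / real n - pmf \<pi> i) > \<kappa>" using i by (auto simp: s_def)
      then have "s * (real (label_count n \<sigma> i) / real n - pmf \<pi> i) * real n > \<kappa> * real n"
        using \<open>n > 0\<close> by (intro mult_strict_right_mono) auto
      then have "s * (real (label_count n \<sigma> i) - real n * pmf \<pi> i) - \<kappa> * real n \<ge> 0"
        using \<open>n > 0\<close> by (simp add: algebra_simps)
      then have "1 \<le> ?e i s" unfolding e using assms by simp
      also have "\<dots> \<le> (\<Sum>s\<in>{1, -1}. ?e i s)"
        using e_nn by (intro member_le_sum) (auto simp: s_def)
      also have "\<dots> \<le> (\<Sum>i\<in>UNIV. \<Sum>s\<in>{1, -1}. ?e i s)"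
        using e_nn by (intro member_le_sum[of i UNIV "\<lambda>i. \<Sum>s\<in>{1, -1}. ?e i s"] sum_nonneg) auto
      finally show ?thesis using False by simp
    qed
  qed
  also have "\<dots> = (\<Sum>i\<in>UNIV. \<Sum>s\<in>{1, -1}. exp (- (\<kappa>\<^sup>2 / 2) * real n) * (\<Sum>l\<in>UNIV. pmf \<pi> l * exp (\<kappa> / 2 * s * y i l)) ^ n)"
    using label_avg_prod[of n \<pi> "\<lambda>v l. exp (\<kappa> / 2 * s * y i l)" for i s]
    by (simp only: label_avg_sum label_avg_cmult) simp
  also have "\<dots> \<le> (\<Sum>i\<in>(UNIV::'s set). \<Sum>s\<in>{1::real, -1}. exp (- (\<kappa>\<^sup>2 / 4) * real n))"
  proof (intro sum_mono)
    fix i and s :: real assume s: "s \<in> {1, -1}"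
    have y1: "\<bar>y i l\<bar> \<le> 1" for l
      using pmf_le_1[of \<pi> i] pmf_nonneg[of \<pi> i] by (auto simp: y_def)
    have "(\<Sum>l\<in>UNIV. pmf \<pi> l * exp (\<kappa> / 2 * s * y i l)) \<le> (\<Sum>l\<in>UNIV. pmf \<pi> l * (1 + \<kappa> / 2 * s * y i l + \<kappa>\<^sup>2 / 4))"
    proof (intro sum_mono mult_left_mono)
      fix l
      have "\<bar>\<kappa> / 2 * s * y i l\<bar> \<le> \<kappa> / 2 * 1 * 1"
        unfolding abs_mult using s y1 assms by (intro mult_mono) auto
      then have b: "\<bar>\<kappa> / 2 * s * y i l\<bar> \<le> \<kappa> / 2" by simp
      then have "(\<kappa> / 2 * s * y i l)\<^sup>2 \<le> (\<kappa> / 2)\<^sup>2" 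
        using assms by (intro abs_le_square_iff[THEN iffD1]) simp
      \<comment> \<open>As \<open>\<kappa> \<le> 1\<close>, the exponent is at most
        \<open>1 / 2\<close> in absolute value, and \<open>exp (1 / 2) \<le> 2\<close> reduces the
        Taylor constant to 1.\<close>
      moreover have "exp (1 / 2) / 2 * (\<kappa> / 2 * s * y i l)\<^sup>2 \<le> 1 * (\<kappa> / 2 * s * y i l)\<^sup>2"
        using exp_half_le2 by (intro mult_right_mono) auto
      moreover have "exp (\<kappa> / 2 * s * y i l) \<le> 1 + \<kappa> / 2 * s * y i l + exp (1 / 2) / 2 * (\<kappa> / 2 * s * y i l)\<^sup>2"
        using b assms by (intro exp_quadratic_upper) auto
      ultimately show "exp (\<kappa> / 2 * s * y i l) \<le> 1 + \<kappa> / 2 * s * y i l + \<kappa>\<^sup>2 / 4"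
        by (simp add: power_divide)
    qed auto
    also have "\<dots> = 1 + \<kappa> / 2 * s * (\<Sum>l\<in>UNIV. pmf \<pi> l * y i l) + \<kappa>\<^sup>2 / 4"
      by (simp add: distrib_left sum.distrib sum_distrib_left sum_distrib_right[symmetric] sum_divide_distrib[symmetric] sum_pmf_eq_1 mult_ac)
    also have "(\<Sum>l\<in>UNIV. pmf \<pi> l * y i l) = 0"
      by (simp add: y_def right_diff_distrib sum_subtractf sum_distrib_right[symmetric] sum_pmf_eq_1)
    also have "1 + \<kappa> / 2 * s * 0 + \<kappa>\<^sup>2 / 4 \<le> exp (\<kappa>\<^sup>2 / 4)"
      using exp_ge_add_one_self[of "\<kappa>\<^sup>2 / 4"] by simp
    finally have "(\<Sum>l\<in>UNIV. pmf \<pi> l * exp (\<kappa> / 2 * s * y i l)) ^ n \<le> exp (\<kappa>\<^sup>2 / 4) ^ n"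
      by (intro power_mono sum_nonneg mult_nonneg_nonneg) auto
    then have "exp (- (\<kappa>\<^sup>2 / 2) * real n) * (\<Sum>l\<in>UNIV. pmf \<pi> l * exp (\<kappa> / 2 * s * y i l)) ^ n
        \<le> exp (- (\<kappa>\<^sup>2 / 2) * real n) * exp (\<kappa>\<^sup>2 / 4) ^ n" by (intro mult_left_mono) auto
    also have "\<dots> = exp (- (\<kappa>\<^sup>2 / 4) * real n)"
      by (simp add: exp_of_nat_mult[symmetric] exp_add[symmetric] algebra_simps)
    finally show "exp (- (\<kappa>\<^sup>2 / 2) * real n) * (\<Sum>l\<in>UNIV. pmf \<pi> l * exp (\<kappa> / 2 * s * y i l)) ^ n
        \<le> exp (- (\<kappa>\<^sup>2 / 4) * real n)" .
  qed
  finally show ?thesis by simp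
qed

section \<open>The likelihood ratio kernel\<close>

definition vertex_pairs :: "nat \<Rightarrow> (nat \<times> nat) set" where
  "vertex_pairs n = {(u, v). 1 \<le> u \<and> u < v \<and> v \<le> n}"

text \<open>Edge indicators on pairs with the smaller vertex first; the default \<open>False\<close>
  is the one in \<open>sbm_graph\<close>.\<close>

definition edge_sets :: "nat \<Rightarrow> (nat \<times> nat \<Rightarrow> bool) set" where
  "edge_sets n = PiE_dflt (vertex_pairs n) False (\<lambda>_. UNIV)"

definition edge_pmf :: "nat \<Rightarrow> (nat \<times> nat \<Rightarrow> real) \<Rightarrow> (nat \<times> nat \<Rightarrow> bool) \<Rightarrow> real" where
  "edge_pmf n r X = (\<Prod>e\<in>vertex_pairs n. pmf (bernoulli_pmf (r e)) (X e))"

lemma finite_vertex_pairs [simp, intro]: "finite (vertex_pairs n)"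
  by (rule finite_subset[of _ "{1..n} \<times> {1..n}"]) (auto simp: vertex_pairs_def)

lemma finite_edge_sets [simp, intro]: "finite (edge_sets n)"
  unfolding edge_sets_def by (rule finite_PiE_dflt) auto

lemma edge_pmf_nonneg: "edge_pmf n r X \<ge> 0"
  unfolding edge_pmf_def by (intro prod_nonneg) auto

lemma sum_edge_pmf: "(\<Sum>X\<in>edge_sets n. edge_pmf n r X) = 1"
  unfolding edge_sets_def edge_pmf_def
  by (subst sum_prod_PiE_dflt) (auto intro!: prod.neutral simp: sum_pmf_eq_1)

lemma edge_pmf_pos:
  assumes "\<And>e. 0 < r e" "\<And>e. r e < 1"
  shows "edge_pmf n r X > 0"
  unfolding edge_pmf_def
proof (rule prod_pos)
  fix e
  show "0 < pmf (bernoulli_pmf (r e)) (X e)"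
    using assms[of e] by (cases "X e") (simp_all add: less_imp_le)
qed

text \<open>Edges are independent under all three laws, so the sum factorises. A single edge
  contributes \<open>(1 - r) * (1 - r') / (1 - q) + r * r' / q\<close>.\<close>

lemma edge_pmf_kernel:
  assumes q: "0 < q" "q < 1"
    and r: "\<And>e. e \<in> vertex_pairs n \<Longrightarrow> 0 \<le> r e \<and> r e \<le> 1" "\<And>e. e \<in> vertex_pairs n \<Longrightarrow> 0 \<le> r' e \<and> r' e \<le> 1"
  shows "(\<Sum>X\<in>edge_sets n. edge_pmf n r X * edge_pmf n r' X / edge_pmf n (\<lambda>_. q) X)
     = (\<Prod>e\<in>vertex_pairs n. 1 + (r e - q) * (r' e - q) / (q * (1 - q)))"
proof -
  have "(\<Sum>X\<in>edge_sets n. edge_pmf n r X * edge_pmf n r' X / edge_pmf n (\<lambda>_. q) X)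
     = (\<Prod>e\<in>vertex_pairs n. \<Sum>b\<in>UNIV. pmf (bernoulli_pmf (r e)) b * pmf (bernoulli_pmf (r' e)) b / pmf (bernoulli_pmf q) b)"
    unfolding edge_sets_def edge_pmf_def prod.distrib[symmetric] prod_dividef[symmetric]
    by (subst sum_prod_PiE_dflt) auto
  also have "\<dots> = (\<Prod>e\<in>vertex_pairs n. 1 + (r e - q) * (r' e - q) / (q * (1 - q)))"
  proof (intro prod.cong refl)
    fix e assume "e \<in> vertex_pairs n"
    then have "(\<Sum>b\<in>UNIV. pmf (bernoulli_pmf (r e)) b * pmf (bernoulli_pmf (r' e)) b / pmf (bernoulli_pmf q) b)
       = (1 - r e) * (1 - r' e) / (1 - q) + r e * r' e / q"
      using r[of e] q by (simp add: UNIV_bool)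
    also have "\<dots> = 1 + (r e - q) * (r' e - q) / (q * (1 - q))"
      using q by (simp add: divide_simps) (simp add: algebra_simps)
    finally show "(\<Sum>b\<in>UNIV. pmf (bernoulli_pmf (r e)) b * pmf (bernoulli_pmf (r' e)) b / pmf (bernoulli_pmf q) b) = \<dots>" .
  qed
  finally show ?thesis .
qed

text \<open>The square of vertices splits into the pairs, their mirror images and the
  diagonal.\<close>

lemma sum_vertex_pairs:
  fixes f :: "nat \<Rightarrow> nat \<Rightarrow> real"
  assumes "\<And>u v. f u v = f v u"
  shows "2 * (\<Sum>(u, v)\<in>vertex_pairs n. f u v) = (\<Sum>u\<in>{1..n}. \<Sum>v\<in>{1..n}. f u v) - (\<Sum>u\<in>{1..n}. f u u)"
proof -
  let ?g = "\<lambda>(u, v). f u v"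
  have "(\<Sum>u\<in>{1..n}. \<Sum>v\<in>{1..n}. f u v) = sum ?g ({1..n} \<times> {1..n})"
    by (simp add: sum.cartesian_product)
  also have "{1..n} \<times> {1..n} = vertex_pairs n \<union> (prod.swap ` vertex_pairs n \<union> (\<lambda>u. (u, u)) ` {1..n})"
  proof (intro equalityI subsetI)
    fix x assume "x \<in> {1..n} \<times> {1..n}"
    then obtain u v where x: "x = (u, v)" "u \<in> {1..n}" "v \<in> {1..n}" by auto
    consider "u < v" | "v < u" | "u = v" by linarith
    then show "x \<in> vertex_pairs n \<union> (prod.swap ` vertex_pairs n \<union> (\<lambda>u. (u, u)) ` {1..n})"
    proof cases
      case 2
      then have "(v, u) \<in> vertex_pairs n" using x by (simp add: vertex_pairs_def)
      then show ?thesis using x by (auto intro: image_eqI[of _ _ "(v, u)"])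
    qed (use x in \<open>auto simp: vertex_pairs_def\<close>)
  qed (auto simp: vertex_pairs_def)
  also have "sum ?g \<dots> = sum ?g (vertex_pairs n) + (sum ?g (prod.swap ` vertex_pairs n) + sum ?g ((\<lambda>u. (u, u)) ` {1..n}))"
    by (subst sum.union_disjoint, simp, simp, force simp: vertex_pairs_def,
        subst sum.union_disjoint, simp, simp, force simp: vertex_pairs_def) simp
  also have "sum ?g (prod.swap ` vertex_pairs n) = sum ?g (vertex_pairs n)"
    by (subst sum.reindex) (auto intro!: sum.cong inj_onI simp: assms)
  also have "sum ?g ((\<lambda>u. (u, u)) ` {1..n}) = (\<Sum>u\<in>{1..n}. f u u)"
    by (subst sum.reindex) (auto intro!: inj_onI)
  finally show ?thesis by simp
qed

lemma sum_kron_emp: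
  assumes "n > 0"
  shows "(\<Sum>u\<in>{1..n}. \<Sum>v\<in>{1..n}. B $ \<sigma> u $ \<sigma> v * B $ \<tau> u $ \<tau> v)
     = (real n)\<^sup>2 * kron_form B (emp n \<sigma> \<tau>)"
proof -
  let ?a = "emp n \<sigma> \<tau>"
  have "(\<Sum>u\<in>{1..n}. \<Sum>v\<in>{1..n}. B $ \<sigma> u $ \<sigma> v * B $ \<tau> u $ \<tau> v)
      = (\<Sum>u\<in>{1..n}. real n * (\<Sum>l\<in>UNIV. ?a $ l * (B $ \<sigma> u $ fst l * B $ \<tau> u $ snd l)))"
    by (intro sum.cong refl sum_emp[OF assms])
  also have "\<dots> = real n * (\<Sum>k\<in>UNIV. ?a $ k * (real n * (\<Sum>l\<in>UNIV. ?a $ l * (B $ fst k $ fst l * B $ snd k $ snd l))))"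
    by (rule sum_emp[OF assms])
  also have "\<dots> = (real n)\<^sup>2 * kron_form B ?a"
    unfolding kron_form_expand by (simp add: sum_distrib_left power2_eq_square mult_ac)
  finally show ?thesis .
qed

abbreviation sbm_edge_prob :: "nat \<Rightarrow> real ^ 's ^ 's \<Rightarrow> 's::finite labelling \<Rightarrow> nat \<times> nat \<Rightarrow> real" where
  "sbm_edge_prob n M \<sigma> \<equiv> \<lambda>(u, v). min 1 (M $ \<sigma> u $ \<sigma> v / real n)"

text \<open>Each factor of the kernel is bounded by \<open>1 + y \<le> exp y\<close>. The exponents
  sum to the quadratic form, up to the diagonal terms and the replacement of
  \<open>real n - d\<close> by \<open>real n\<close>, both of which cost only a constant
  factor.\<close>

lemma sbm_kernel_le:
  fixes M :: "real ^ 's::finite ^ 's"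
  assumes sym: "transpose M = M" and nn: "\<And>i j. M $ i $ j \<ge> 0" and d: "d > 0"
    and B: "B = (M - (\<chi> i j. d)) /\<^sub>R sqrt (2 * d)"
  obtains C where "C > 0" "eventually (\<lambda>n. n > 0 \<and> d / real n < 1 \<and> (\<forall>\<sigma> \<tau>.
     (\<Sum>X\<in>edge_sets n. edge_pmf n (sbm_edge_prob n M \<sigma>) X * edge_pmf n (sbm_edge_prob n M \<tau>) X
        / edge_pmf n (\<lambda>_. d / real n) X) \<le> C * exp (real n * kron_form B (emp n \<sigma> \<tau>)))) sequentially"
proof -
  define m where "m = (\<Sum>i\<in>UNIV. \<Sum>j\<in>UNIV. M $ i $ j)"
  have Mm: "M $ i $ j \<le> m" for i j
  proof -
    have "M $ i $ j \<le> (\<Sum>j\<in>UNIV. M $ i $ j)" by (intro member_le_sum) (auto simp: nn)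
    also have "\<dots> \<le> m" unfolding m_def
      by (intro member_le_sum[of i UNIV "\<lambda>i. \<Sum>j\<in>UNIV. M $ i $ j"] sum_nonneg) (auto simp: nn)
    finally show ?thesis .
  qed
  define b where "b = ((m + d) / sqrt (2 * d))\<^sup>2"
  have B_nth: "B $ i $ j = (M $ i $ j - d) / sqrt (2 * d)" for i j
    unfolding B by (simp add: divide_inverse mult.commute)
  have B_le: "\<bar>B $ i $ j\<bar> \<le> (m + d) / sqrt (2 * d)" for i j
  proof -
    have "\<bar>M $ i $ j - d\<bar> \<le> m + d" using Mm[of i j] nn[of i j] d by linarith
    then show ?thesis unfolding B_nth using d by (simp add: divide_right_mono)
  qed
  have bb: "\<bar>B $ i $ j * B $ k $ l\<bar> \<le> b" for i j k l
    unfolding b_def power2_eq_square abs_mult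
    using B_le abs_ge_zero order.trans by (intro mult_mono) blast+
  have b0: "b \<ge> 0" by (simp add: b_def)
  have symB: "B $ i $ j = B $ j $ i" for i j
    using sym unfolding B_nth by (metis transpose_def vec_lambda_beta)
  show ?thesis
  \<comment> \<open>The excess of the exponent over \<open>real n * ?K\<close> is at most
    \<open>real n * ((d + 1) * b) / (real n - d)\<close>, and
    \<open>real n \<le> 2 * (real n - d)\<close>.\<close>
  proof (rule that[of "exp (2 * (d + 1) * b)"])
    \<comment> \<open>The three thresholds serve, in order, the comparison of \<open>real n\<close>
      with \<open>real n - d\<close>, the removal of \<open>min 1\<close> from the edge
      probabilities, and the non-negativity of the factors of the product.\<close>
    have "eventually (\<lambda>n. real n > 2 * d \<and> real n > m \<and> real n > d + 2 * b) sequentially"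
      by (intro eventually_conj filterlim_real_sequentially[THEN filterlim_at_top_dense[THEN iffD1], rule_format])
    then show "eventually (\<lambda>n. n > 0 \<and> d / real n < 1 \<and> (\<forall>\<sigma> \<tau>.
     (\<Sum>X\<in>edge_sets n. edge_pmf n (sbm_edge_prob n M \<sigma>) X * edge_pmf n (sbm_edge_prob n M \<tau>) X
        / edge_pmf n (\<lambda>_. d / real n) X) \<le> exp (2 * (d + 1) * b) * exp (real n * kron_form B (emp n \<sigma> \<tau>)))) sequentially"
    proof eventually_elim
      case (elim n)
      then have n: "real n > 2 * d" "real n > m" "real n > d + 2 * b" by auto
      then have n0: "n > 0" "real n > d" using d by (auto intro: gr0I)
      then have q: "0 < d / real n" "d / real n < 1" using d by auto
      show ?case
      proof (intro conjI allI n0(1) q(2))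
        fix \<sigma> \<tau> :: "'s labelling"
        define f where "f u v = B $ \<sigma> u $ \<sigma> v * B $ \<tau> u $ \<tau> v" for u v
        let ?K = "kron_form B (emp n \<sigma> \<tau>)"
        have r: "M $ i $ j / real n \<le> 1" "0 \<le> M $ i $ j / real n" for i j
          using nn[of i j] Mm[of i j] n n0 by auto
        then have r': "min 1 (M $ i $ j / real n) = M $ i $ j / real n" for i j by simp
        have "(\<Sum>X\<in>edge_sets n. edge_pmf n (sbm_edge_prob n M \<sigma>) X * edge_pmf n (sbm_edge_prob n M \<tau>) X
            / edge_pmf n (\<lambda>_. d / real n) X)
          = (\<Prod>e\<in>vertex_pairs n. 1 + (sbm_edge_prob n M \<sigma> e - d / real n) * (sbm_edge_prob n M \<tau> e - d / real n)
              / (d / real n * (1 - d / real n)))"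
          by (rule edge_pmf_kernel[OF q]) (auto simp: r nn)
        also have "\<dots> = (\<Prod>e\<in>vertex_pairs n. 1 + (case e of (u, v) \<Rightarrow> 2 * f u v / (real n - d)))"
        proof (intro prod.cong refl)
          fix e assume "e \<in> vertex_pairs n"
          obtain u v where e: "e = (u, v)" by (cases e)
          \<comment> \<open>The normalisation by \<open>sqrt (2 * d)\<close> produces a factor 2,
            which turns the sum over unordered pairs into the sum over ordered ones.\<close>
          have "sqrt (2 * d) * sqrt (2 * d) = 2 * d" using d by simp
          then have ff: "2 * f u v = (M $ \<sigma> u $ \<sigma> v - d) * (M $ \<tau> u $ \<tau> v - d) / d"
            using d unfolding f_def B_nth by (simp add: field_simps)
          have "(M $ \<sigma> u $ \<sigma> v / real n - d / real n) * (M $ \<tau> u $ \<tau> v / real n - d / real n)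
              / (d / real n * (1 - d / real n)) = 2 * f u v / (real n - d)"
            unfolding ff using n0 d by (simp add: divide_simps)
          then show "1 + (sbm_edge_prob n M \<sigma> e - d / real n) * (sbm_edge_prob n M \<tau> e - d / real n)
              / (d / real n * (1 - d / real n)) = 1 + (case e of (u, v) \<Rightarrow> 2 * f u v / (real n - d))"
            by (simp add: e r')
        qed
        also have "\<dots> \<le> (\<Prod>e\<in>vertex_pairs n. exp (case e of (u, v) \<Rightarrow> 2 * f u v / (real n - d)))"
        proof (rule prod_mono, intro conjI exp_ge_add_one_self)
          fix e assume "e \<in> vertex_pairs n"
          obtain u v where e: "e = (u, v)" by (cases e)
          have "2 * \<bar>f u v\<bar> \<le> 2 * b" unfolding f_def using bb by simp
          show "0 \<le> 1 + (case e of (u, v) \<Rightarrow> 2 * f u v / (real n - d))"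
            using \<open>2 * \<bar>f u v\<bar> \<le> 2 * b\<close> n by (simp add: e field_simps abs_le_iff)
        qed
        also have "\<dots> = exp (2 * (\<Sum>(u, v)\<in>vertex_pairs n. f u v) / (real n - d))"
          by (simp add: exp_sum[symmetric] sum_distrib_left sum_divide_distrib case_prod_unfold)
        also have "2 * (\<Sum>(u, v)\<in>vertex_pairs n. f u v) = (real n)\<^sup>2 * ?K - (\<Sum>u\<in>{1..n}. f u u)"
          using sum_vertex_pairs[of f n] sum_kron_emp[OF n0(1), of B \<sigma> \<tau>] symB by (simp add: f_def)
        also have "((real n)\<^sup>2 * ?K - (\<Sum>u\<in>{1..n}. f u u)) / (real n - d) \<le> real n * ?K + 2 * (d + 1) * b"
        proof -
          have "\<bar>?K\<bar> * (real n)\<^sup>2 \<le> (\<Sum>u\<in>{1..n}. \<Sum>v\<in>{1..n}. b)"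
          proof -
            have "\<bar>?K\<bar> * (real n)\<^sup>2 = \<bar>\<Sum>u\<in>{1..n}. \<Sum>v\<in>{1..n}. f u v\<bar>"
              unfolding f_def sum_kron_emp[OF n0(1)] by (simp add: abs_mult)
            also have "\<dots> \<le> (\<Sum>u\<in>{1..n}. \<bar>\<Sum>v\<in>{1..n}. f u v\<bar>)" by (rule sum_abs)
            also have "\<dots> \<le> (\<Sum>u\<in>{1..n}. \<Sum>v\<in>{1..n}. b)"
              unfolding f_def by (intro sum_mono order.trans[OF sum_abs] bb)
            finally show ?thesis .
          qed
          also have "\<dots> = b * (real n)\<^sup>2" by (simp add: power2_eq_square)
          finally have K: "\<bar>?K\<bar> \<le> b" using n0(1) by simp
          have "- (\<Sum>u\<in>{1..n}. f u u) \<le> (\<Sum>u\<in>{1..n}. b)"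
            unfolding sum_negf[symmetric] f_def by (intro sum_mono) (use bb abs_le_D2 in blast)
          then have S: "- (\<Sum>u\<in>{1..n}. f u u) \<le> real n * b" by simp
          have "real n * d * ?K \<le> real n * d * b" using K d by (intro mult_left_mono) auto
          with S have "(real n)\<^sup>2 * ?K - (\<Sum>u\<in>{1..n}. f u u)
              \<le> (real n - d) * (real n * ?K) + real n * ((d + 1) * b)"
            by (simp add: power2_eq_square algebra_simps)
          also have "\<dots> \<le> (real n - d) * (real n * ?K) + (2 * (real n - d)) * ((d + 1) * b)"
            using n d b0 by (intro add_left_mono mult_right_mono) auto
          also have "\<dots> = (real n * ?K + 2 * (d + 1) * b) * (real n - d)" by (simp add: algebra_simps)
          finally show ?thesis using n0 by (simp add: divide_le_eq)
        qed
        finally show "(\<Sum>X\<in>edge_sets n. edge_pmf n (sbm_edge_prob n M \<sigma>) X * edge_pmf n (sbm_edge_prob n M \<tau>) X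
            / edge_pmf n (\<lambda>_. d / real n) X) \<le> exp (2 * (d + 1) * b) * exp (real n * ?K)"
          by (simp add: exp_add[symmetric] add.commute)
      qed
    qed
  qed simp
qed

section \<open>The success probability as a finite sum\<close>

lemma prob_bind_pmf:
  "measure_pmf.prob (bind_pmf p f) S = (\<integral>x. measure_pmf.prob (f x) S \<partial>measure_pmf p)"
proof -
  have *: "measure_pmf.prob q S = pmf (map_pmf (\<lambda>x. x \<in> S) q) True" for q :: "'a pmf"
    by (simp add: pmf_map vimage_def)
  show ?thesis by (simp only: * map_bind_pmf pmf_bind)
qed

text \<open>Both product laws are supported on finite sets with matching default values, so the
  integrals are finite sums.\<close>

lemma prob_sbm:
  fixes \<A> :: "graph \<Rightarrow> 's::finite labelling"
  shows "measure_pmf.prob (sbm n M \<pi>) {(G, \<sigma>). overlap n (\<A> G) \<sigma> > \<delta>}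
    = label_avg n \<pi> (\<lambda>\<sigma>. \<Sum>X\<in>edge_sets n. edge_pmf n (sbm_edge_prob n M \<sigma>) X *
        of_bool (overlap n (\<A> ({1..n}, {{u, v} | u v. X (u, v)})) \<sigma> > \<delta>))"
proof -
  let ?G = "\<lambda>X. ({1..n}, {{u, v} | u v. X (u, v)}) :: graph"
  have inner: "measure_pmf.prob (sbm_graph n M \<sigma> \<bind> (\<lambda>G. return_pmf (G, \<sigma>))) {(G, \<sigma>). overlap n (\<A> G) \<sigma> > \<delta>}
      = (\<Sum>X\<in>edge_sets n. edge_pmf n (sbm_edge_prob n M \<sigma>) X * of_bool (overlap n (\<A> (?G X)) \<sigma> > \<delta>))" for \<sigma>
  proof -
    let ?P = "Pi_pmf (vertex_pairs n) False (\<lambda>(u, v). bernoulli_pmf (min 1 (M $ \<sigma> u $ \<sigma> v / real n)))"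
    have sub: "set_pmf ?P \<subseteq> edge_sets n"
      using set_Pi_pmf_subset[of "vertex_pairs n" False] by (auto simp: edge_sets_def PiE_dflt_def)
    have "measure_pmf.prob (sbm_graph n M \<sigma> \<bind> (\<lambda>G. return_pmf (G, \<sigma>))) {(G, \<sigma>). overlap n (\<A> G) \<sigma> > \<delta>}
        = measure_pmf.prob ?P {X. overlap n (\<A> (?G X)) \<sigma> > \<delta>}"
      unfolding sbm_graph_def vertex_pairs_def by (simp add: map_pmf_def[symmetric] vimage_def)
    also have "\<dots> = (\<integral>X. of_bool (overlap n (\<A> (?G X)) \<sigma> > \<delta>) \<partial>measure_pmf ?P)"
      by (subst Bochner_Integration.integral_cong[OF refl, of _ _ "indicator {X. overlap n (\<A> (?G X)) \<sigma> > \<delta>}"])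
        (auto simp: indicator_def)
    also have "\<dots> = (\<Sum>X\<in>edge_sets n. of_bool (overlap n (\<A> (?G X)) \<sigma> > \<delta>) * pmf ?P X)"
      using sub by (intro integral_measure_pmf_real) auto
    also have "\<dots> = (\<Sum>X\<in>edge_sets n. edge_pmf n (sbm_edge_prob n M \<sigma>) X * of_bool (overlap n (\<A> (?G X)) \<sigma> > \<delta>))"
    proof (intro sum.cong refl)
      fix X assume "X \<in> edge_sets n"
      then have "pmf ?P X = edge_pmf n (sbm_edge_prob n M \<sigma>) X"
        unfolding edge_pmf_def
        by (subst pmf_Pi') (auto simp: edge_sets_def PiE_dflt_def intro!: prod.cong)
      then show "of_bool (overlap n (\<A> (?G X)) \<sigma> > \<delta>) * pmf ?P X
        = edge_pmf n (sbm_edge_prob n M \<sigma>) X * of_bool (overlap n (\<A> (?G X)) \<sigma> > \<delta>)" by simp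
    qed
    finally show ?thesis .
  qed
  let ?L = "Pi_pmf {1..n} undefined (\<lambda>_. \<pi>)"
  have "set_pmf ?L \<subseteq> labellings n"
    using set_Pi_pmf_subset[of "{1..n}" "undefined :: 's"] by (auto simp: labellings_def PiE_dflt_def)
  then have "measure_pmf.prob (sbm n M \<pi>) {(G, \<sigma>). overlap n (\<A> G) \<sigma> > \<delta>}
      = (\<Sum>\<sigma>\<in>labellings n. (\<Sum>X\<in>edge_sets n. edge_pmf n (sbm_edge_prob n M \<sigma>) X *
        of_bool (overlap n (\<A> (?G X)) \<sigma> > \<delta>)) * pmf ?L \<sigma>)"
    unfolding sbm_def prob_bind_pmf[of ?L] inner by (intro integral_measure_pmf_real) auto
  also have "\<dots> = label_avg n \<pi> (\<lambda>\<sigma>. \<Sum>X\<in>edge_sets n. edge_pmf n (sbm_edge_prob n M \<sigma>) X *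
        of_bool (overlap n (\<A> (?G X)) \<sigma> > \<delta>))"
    unfolding label_avg_def
  proof (intro sum.cong refl)
    fix \<sigma> :: "'s labelling" assume "\<sigma> \<in> labellings n"
    then have "pmf ?L \<sigma> = (\<Prod>v\<in>{1..n}. pmf \<pi> (\<sigma> v))"
      by (intro pmf_Pi') (auto simp: labellings_def PiE_dflt_def)
    then show "(\<Sum>X\<in>edge_sets n. edge_pmf n (sbm_edge_prob n M \<sigma>) X *
        of_bool (overlap n (\<A> (?G X)) \<sigma> > \<delta>)) * pmf ?L \<sigma> = (\<Prod>v\<in>{1..n}. pmf \<pi> (\<sigma> v)) *
        (\<Sum>X\<in>edge_sets n. edge_pmf n (sbm_edge_prob n M \<sigma>) X * of_bool (overlap n (\<A> (?G X)) \<sigma> > \<delta>))"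
      by simp
  qed
  finally show ?thesis .
qed

section \<open>The overlap of an estimate with the labelling\<close>

definition centred :: "'s::finite pmf \<Rightarrow> 's \<Rightarrow> 's \<Rightarrow> real" where
  "centred \<pi> j l = of_bool (l = j) - pmf \<pi> j"

lemma abs_centred_le: "\<bar>centred \<pi> j l\<bar> \<le> 1"
  using pmf_le_1[of \<pi> j] pmf_nonneg[of \<pi> j] by (auto simp: centred_def)

lemma sum_centred: "(\<Sum>l\<in>UNIV. pmf \<pi> l * centred \<pi> j l) = 0"
  by (simp add: centred_def right_diff_distrib sum_subtractf sum_distrib_right[symmetric] sum_pmf_eq_1)

text \<open>Fix an optimal permutation. Replacing the label frequencies of \<open>\<sigma>\<close>
  by \<open>\<pi>\<close> costs at most \<open>\<kappa>\<close> per label, hence at most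
  \<open>\<delta> / 2\<close> in all; of the remaining more than \<open>\<delta> / 2\<close>, one of
  the \<open>CARD('s)\<close> labels carries more than its equal share.\<close>

lemma overlap_large_imp:
  fixes \<sigma> \<tau> :: "'s::finite labelling"
  assumes "overlap n \<tau> \<sigma> > \<delta>" "balanced \<kappa> n \<pi> \<sigma>" "\<kappa> \<le> \<delta> / (2 * real CARD('s))" "n > 0"
  obtains i j where "(\<Sum>v\<in>{1..n}. of_bool (\<tau> v = i) * centred \<pi> j (\<sigma> v)) / real n > \<delta> / (2 * real CARD('s))"
proof -
  define g where "g i j = (\<Sum>v\<in>{1..n}. of_bool (\<tau> v = i) * centred \<pi> j (\<sigma> v)) / real n" for i j
  define t where "t \<rho> = (\<Sum>i\<in>UNIV. real (joint_label_count n \<tau> \<sigma> i (\<rho> i))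
        - 1 / real n * real (label_count n \<tau> i) * real (label_count n \<sigma> (\<rho> i)))" for \<rho>
  have "Max (t ` {\<rho>. \<rho> permutes UNIV}) \<in> t ` {\<rho>. \<rho> permutes UNIV}"
    using finite_permutations[of "UNIV :: 's set"]
    by (intro Max_in) (auto intro: exI[of _ id] permutes_id)
  then obtain \<rho> where "Max (t ` {\<rho>. \<rho> permutes UNIV}) = t \<rho>" by auto
  then have big: "1 / real n * t \<rho> > \<delta>" using assms(1) unfolding overlap_def t_def by simp
  have "\<exists>i j. g i j > \<delta> / (2 * real CARD('s))"
  proof (rule ccontr)
    assume "\<nexists>i j. g i j > \<delta> / (2 * real CARD('s))"
    then have small: "g i j \<le> \<delta> / (2 * real CARD('s))" for i j by (meson not_le)
    have "1 / real n * t \<rho> = (\<Sum>i\<in>UNIV. g i (\<rho> i)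
        + real (label_count n \<tau> i) / real n * (pmf \<pi> (\<rho> i) - real (label_count n \<sigma> (\<rho> i)) / real n))"
      unfolding t_def sum_distrib_left
    proof (intro sum.cong refl)
      fix i
      have "(\<Sum>v\<in>{1..n}. of_bool (\<tau> v = i) * centred \<pi> (\<rho> i) (\<sigma> v))
          = (\<Sum>v\<in>{1..n}. of_bool (\<tau> v = i \<and> \<sigma> v = \<rho> i) - of_bool (\<tau> v = i) * pmf \<pi> (\<rho> i))"
        by (intro sum.cong refl) (simp add: centred_def)
      also have "\<dots> = real (joint_label_count n \<tau> \<sigma> i (\<rho> i)) - real (label_count n \<tau> i) * pmf \<pi> (\<rho> i)"
        by (simp add: sum_subtractf sum_distrib_right[symmetric] joint_label_count_def label_count_def
            of_bool_def sum.If_cases Int_def)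
      finally have "real n * g i (\<rho> i) = \<dots>" using assms(4) by (simp add: g_def)
      then have "real (joint_label_count n \<tau> \<sigma> i (\<rho> i)) = real n * g i (\<rho> i) + real (label_count n \<tau> i) * pmf \<pi> (\<rho> i)"
        by simp
      then show "1 / real n * (real (joint_label_count n \<tau> \<sigma> i (\<rho> i))
          - 1 / real n * real (label_count n \<tau> i) * real (label_count n \<sigma> (\<rho> i))) = g i (\<rho> i)
        + real (label_count n \<tau> i) / real n * (pmf \<pi> (\<rho> i) - real (label_count n \<sigma> (\<rho> i)) / real n)"
        using assms(4) by (simp add: field_simps)
    qed
    also have "\<dots> \<le> (\<Sum>i\<in>(UNIV::'s set). \<delta> / (2 * real CARD('s)) + \<delta> / (2 * real CARD('s)))"
    proof (intro sum_mono add_mono small)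
      fix i
      have "label_count n \<tau> i \<le> card {1..n}" unfolding label_count_def by (rule card_mono) auto
      then have l: "real (label_count n \<tau> i) / real n \<le> 1" using assms(4) by simp
      have dev: "\<bar>pmf \<pi> (\<rho> i) - real (label_count n \<sigma> (\<rho> i)) / real n\<bar> \<le> \<kappa>"
        using assms(2) unfolding balanced_def by (metis abs_minus_commute)
      have "real (label_count n \<tau> i) / real n * (pmf \<pi> (\<rho> i) - real (label_count n \<sigma> (\<rho> i)) / real n) \<le>
         real (label_count n \<tau> i) / real n * \<bar>pmf \<pi> (\<rho> i) - real (label_count n \<sigma> (\<rho> i)) / real n\<bar>"
        by (intro mult_left_mono) auto
      also have "\<dots> \<le> 1 * \<kappa>" using l dev by (intro mult_mono) auto
      finally show "real (label_count n \<tau> i) / real n * (pmf \<pi> (\<rho> i) - real (label_count n \<sigma> (\<rho> i)) / real n) \<le> \<delta> / (2 * real CARD('s))"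
        using assms(3) by simp
    qed
    also have "\<dots> = \<delta>" by simp
    finally show False using big by simp
  qed
  then show ?thesis using that unfolding g_def by blast
qed

text \<open>An instance of \<open>second_moment_bound\<close> in which the reference law has
  constant edge probability \<open>q\<close> and both sides are normalised by
  \<open>n\<close>.\<close>

lemma posterior_square_le:
  fixes \<pi> :: "'s::finite pmf" and x :: "nat \<Rightarrow> (nat \<times> nat \<Rightarrow> bool) \<Rightarrow> real"
  assumes "0 < q" "q < 1" and x: "\<And>v X. \<bar>x v X\<bar> \<le> 1" and n: "n > 0"
  shows "(label_avg n \<pi> (\<lambda>\<sigma>. \<Sum>X\<in>edge_sets n. edge_pmf n (r \<sigma>) X * (of_bool (S \<sigma>) *
            ((\<Sum>v\<in>{1..n}. x v X * centred \<pi> j (\<sigma> v)) / real n)\<^sup>2)))\<^sup>2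
    \<le> label_avg2 n \<pi> (\<lambda>\<sigma> \<tau>. of_bool (S \<sigma> \<and> S \<tau>) *
          ((\<Sum>X\<in>edge_sets n. edge_pmf n (r \<sigma>) X * edge_pmf n (r \<tau>) X / edge_pmf n (\<lambda>_. q) X) *
           ((\<Sum>v\<in>{1..n}. centred \<pi> j (\<sigma> v) * centred \<pi> j (\<tau> v)) / real n)\<^sup>2))"
proof -
  \<comment> \<open>The restriction to \<open>S\<close> is absorbed in the weight and so applies to
    both copies.\<close>
  define w where "w \<sigma> = (\<Prod>v\<in>{1..n}. pmf \<pi> (\<sigma> v)) * of_bool (S \<sigma>)" for \<sigma> :: "'s labelling"
  define K where "K \<sigma> \<tau> = (\<Sum>X\<in>edge_sets n. edge_pmf n (r \<sigma>) X * edge_pmf n (r \<tau>) X / edge_pmf n (\<lambda>_. q) X)" for \<sigma> \<tau>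
  define g where "g \<sigma> X = (\<Sum>v\<in>{1..n}. x v X * centred \<pi> j (\<sigma> v))" for \<sigma> X
  define h where "h \<sigma> \<tau> = (\<Sum>v\<in>{1..n}. centred \<pi> j (\<sigma> v) * centred \<pi> j (\<tau> v))" for \<sigma> \<tau>
  let ?T = "\<Sum>\<sigma>\<in>labellings n. w \<sigma> * (\<Sum>X\<in>edge_sets n. edge_pmf n (r \<sigma>) X * (g \<sigma> X)\<^sup>2)"
  let ?U = "\<Sum>\<sigma>\<in>labellings n. w \<sigma> * (\<Sum>\<tau>\<in>labellings n. w \<tau> * (K \<sigma> \<tau> * (h \<sigma> \<tau>)\<^sup>2))"
  have "?T\<^sup>2 \<le> (real (card {1..n}))\<^sup>2 * ?U"
    unfolding K_def g_def h_def
    by (rule second_moment_bound[where y = "\<lambda>v \<sigma>. centred \<pi> j (\<sigma> v)"])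
      (auto intro: edge_pmf_pos assms sum_edge_pmf x)
  then have "(?T / (real n)\<^sup>2)\<^sup>2 \<le> ?U / (real n)\<^sup>2"
    using n by (simp add: power_divide field_simps power2_eq_square)
  moreover have "?T / (real n)\<^sup>2 = label_avg n \<pi> (\<lambda>\<sigma>. \<Sum>X\<in>edge_sets n. edge_pmf n (r \<sigma>) X *
      (of_bool (S \<sigma>) * (g \<sigma> X / real n)\<^sup>2))"
    unfolding label_avg_def w_def sum_divide_distrib sum_distrib_left
    by (intro sum.cong refl) (simp add: power_divide mult_ac)
  moreover have "?U / (real n)\<^sup>2 = label_avg2 n \<pi> (\<lambda>\<sigma> \<tau>. of_bool (S \<sigma> \<and> S \<tau>) *
      (K \<sigma> \<tau> * (h \<sigma> \<tau> / real n)\<^sup>2))"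
    unfolding label_avg_def w_def sum_divide_distrib sum_distrib_left
    by (intro sum.cong refl) (simp add: power_divide of_bool_conj mult_ac)
  ultimately show ?thesis unfolding K_def g_def h_def by simp
qed

text \<open>The centred indicator has mean 0 under \<open>\<pi>\<close>, so its tensor square has
  mean 0 under \<open>p\<close> and only the deviation of \<open>emp\<close> from \<open>p\<close>
  contributes. The first bound serves near \<open>p\<close>, the second far from it.\<close>

lemma centred_overlap:
  fixes \<sigma> \<tau> :: "'s::finite labelling"
  assumes "n > 0"
  shows "\<bar>(\<Sum>v\<in>{1..n}. centred \<pi> j (\<sigma> v) * centred \<pi> j (\<tau> v)) / real n\<bar>
    \<le> real CARD('s \<times> 's) * norm (emp n \<sigma> \<tau> - product_coupling \<pi>)"
    and "\<bar>(\<Sum>v\<in>{1..n}. centred \<pi> j (\<sigma> v) * centred \<pi> j (\<tau> v)) / real n\<bar> \<le> 1"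
proof -
  let ?X = "emp n \<sigma> \<tau> - product_coupling \<pi>"
  let ?c = "\<lambda>k. centred \<pi> j (fst k) * centred \<pi> j (snd k)"
  have c1: "\<bar>?c k\<bar> \<le> 1" for k
    unfolding abs_mult by (intro mult_le_one abs_centred_le) auto
  have h: "(\<Sum>v\<in>{1..n}. centred \<pi> j (\<sigma> v) * centred \<pi> j (\<tau> v)) / real n = (\<Sum>k\<in>UNIV. emp n \<sigma> \<tau> $ k * ?c k)"
    using assms sum_emp[OF assms, of "\<lambda>a b. centred \<pi> j a * centred \<pi> j b" \<sigma> \<tau>] by simp
  have "(\<Sum>k\<in>UNIV. product_coupling \<pi> $ k * ?c k)
      = (\<Sum>i\<in>UNIV. pmf \<pi> i * centred \<pi> j i) * (\<Sum>i\<in>UNIV. pmf \<pi> i * centred \<pi> j i)"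
    by (simp add: sum_UNIV_prod sum_product mult_ac)
  then have "(\<Sum>k\<in>UNIV. emp n \<sigma> \<tau> $ k * ?c k) = (\<Sum>k\<in>UNIV. ?X $ k * ?c k)"
    by (simp add: sum_centred left_diff_distrib sum_subtractf)
  also have "\<bar>\<dots>\<bar> \<le> (\<Sum>k\<in>(UNIV :: ('s \<times> 's) set). norm ?X * 1)"
  proof (rule order.trans[OF sum_abs], rule sum_mono)
    fix k
    show "\<bar>?X $ k * ?c k\<bar> \<le> norm ?X * 1"
      unfolding abs_mult[of "?X $ k"] by (intro mult_mono component_le_norm_cart c1) auto
  qed
  finally show "\<bar>(\<Sum>v\<in>{1..n}. centred \<pi> j (\<sigma> v) * centred \<pi> j (\<tau> v)) / real n\<bar>
    \<le> real CARD('s \<times> 's) * norm ?X" unfolding h by simp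
  have "\<bar>\<Sum>k\<in>UNIV. emp n \<sigma> \<tau> $ k * ?c k\<bar> \<le> (\<Sum>k\<in>UNIV. emp n \<sigma> \<tau> $ k * 1)"
  proof (rule order.trans[OF sum_abs], rule sum_mono)
    fix k
    show "\<bar>emp n \<sigma> \<tau> $ k * ?c k\<bar> \<le> emp n \<sigma> \<tau> $ k * 1"
      unfolding abs_mult[of "emp n \<sigma> \<tau> $ k"] abs_of_nonneg[OF emp_nonneg]
      by (intro mult_left_mono c1 emp_nonneg)
  qed
  then show "\<bar>(\<Sum>v\<in>{1..n}. centred \<pi> j (\<sigma> v) * centred \<pi> j (\<tau> v)) / real n\<bar> \<le> 1"
    unfolding h by (simp add: sum_emp_eq_1[OF assms])
qed

lemma balanced_mono: "balanced \<kappa> n \<pi> \<sigma> \<Longrightarrow> \<kappa> \<le> \<kappa>' \<Longrightarrow> balanced \<kappa>' n \<pi> \<sigma>"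
  unfolding balanced_def by (meson order.trans)

lemma exp_decay_poly:
  fixes \<eta> :: real
  assumes "\<eta> > 0"
  shows "(\<lambda>n. exp (- \<eta> * real n) * real (n + 1) ^ k) \<longlonglongrightarrow> 0"
proof -
  have "filterlim (\<lambda>n. \<eta> * real (n + 1)) at_top sequentially"
    using assms by real_asymp
  then have "(\<lambda>n. (\<eta> * real (n + 1)) ^ k / exp (\<eta> * real (n + 1))) \<longlonglongrightarrow> 0"
    by (rule filterlim_compose[OF tendsto_power_div_exp_0])
  then have "(\<lambda>n. exp \<eta> / \<eta> ^ k * ((\<eta> * real (n + 1)) ^ k / exp (\<eta> * real (n + 1)))) \<longlonglongrightarrow> exp \<eta> / \<eta> ^ k * 0"
    by (intro tendsto_intros)
  moreover have "exp \<eta> / \<eta> ^ k * ((\<eta> * real (n + 1)) ^ k / exp (\<eta> * real (n + 1)))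
      = exp (- \<eta> * real n) * real (n + 1) ^ k" for n
  proof -
    have "exp \<eta> / exp (\<eta> * real (n + 1)) = exp (- \<eta> * real n)"
      unfolding exp_diff[symmetric] by (simp add: algebra_simps)
    then show ?thesis unfolding power_mult_distrib using assms by (simp add: field_simps)
  qed
  ultimately show ?thesis by simp
qed

section \<open>Combination of the estimates near and away from the product coupling\<close>

text \<open>Near \<open>p\<close> the square is at most \<open>b\<close> and the exponential moment
  is bounded; elsewhere the square is at most 1 and the moment decays. Any smaller
  \<open>\<kappa>'\<close> is allowed, so that further conditions can be imposed on it.\<close>

lemma weighted_overlap_small:
  fixes \<pi> :: "'s::finite pmf"
  assumes c: "0 \<le> c" "c < 1" "\<And>\<alpha>. \<alpha> \<in> couplings \<pi> \<Longrightarrow>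
       kron_form B (\<alpha> - product_coupling \<pi>) \<le> c * KL_div \<alpha> (product_coupling \<pi>)"
    and B: "transpose B = B" "\<And>i. (\<Sum>j\<in>UNIV. B $ i $ j * pmf \<pi> j) = 0"
    and "t > 0"
  obtains \<kappa> where "\<kappa> > 0" "\<And>\<kappa>'. \<kappa>' \<le> \<kappa> \<Longrightarrow> eventually (\<lambda>n. \<forall>j.
    label_avg2 n \<pi> (\<lambda>\<sigma> \<tau>. of_bool (balanced \<kappa>' n \<pi> \<sigma> \<and> balanced \<kappa>' n \<pi> \<tau>) *
      (exp (real n * kron_form B (emp n \<sigma> \<tau>)) *
       ((\<Sum>v\<in>{1..n}. centred \<pi> j (\<sigma> v) * centred \<pi> j (\<tau> v)) / real n)\<^sup>2)) \<le> t) sequentially"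
proof -
  let ?p = "product_coupling \<pi>" and ?N = "real CARD('s \<times> 's)"
  obtain \<epsilon>0 C where \<epsilon>0: "\<epsilon>0 > 0" and near:
    "eventually (\<lambda>n. label_avg2 n \<pi> (\<lambda>\<sigma> \<tau>. if norm (emp n \<sigma> \<tau> - ?p) < \<epsilon>0
       then exp (real n * kron_form B (emp n \<sigma> \<tau> - ?p)) else 0) \<le> C) sequentially"
    using label_avg2_exp_near[OF c B] by blast
  \<comment> \<open>Makes \<open>b * (\<bar>C\<bar> + 1) = t / 2\<close>; the summand 1 excludes a
    zero denominator.\<close>
  define b where "b = t / (2 * (\<bar>C\<bar> + 1))"
  have b: "b > 0" using \<open>t > 0\<close> by (simp add: b_def)
  \<comment> \<open>The first bound keeps the moment estimate applicable, the second makes the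
    square at most \<open>b\<close>. Only then is \<open>\<kappa>\<close> obtained, as it depends on
    \<open>\<epsilon>\<close>.\<close>
  define \<epsilon> where "\<epsilon> = min \<epsilon>0 (sqrt b / ?N)"
  have \<epsilon>: "\<epsilon> > 0" "\<epsilon> \<le> \<epsilon>0" using \<epsilon>0 b by (auto simp: \<epsilon>_def)
  have "?N > 0" by (simp only: of_nat_0_less_iff zero_less_card_finite)
  moreover have "\<epsilon> \<le> sqrt b / ?N" unfolding \<epsilon>_def by (rule min.cobounded2)
  ultimately have N\<epsilon>: "?N * \<epsilon> \<le> sqrt b" by (simp only: pos_le_divide_eq mult.commute[of ?N])
  obtain \<eta> \<kappa> where \<eta>: "\<eta> > 0" "\<kappa> > 0" and away:
    "\<And>n. n > 0 \<Longrightarrow> label_avg2 n \<pi> (\<lambda>\<sigma> \<tau>.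
       if balanced \<kappa> n \<pi> \<sigma> \<and> balanced \<kappa> n \<pi> \<tau> \<and> norm (emp n \<sigma> \<tau> - ?p) \<ge> \<epsilon>
       then exp (real n * kron_form B (emp n \<sigma> \<tau> - ?p)) else 0)
     \<le> exp (- \<eta> * real n) * real (n + 1) ^ CARD('s \<times> 's)"
    by (rule label_avg2_exp_away[OF c(2,3) \<epsilon>(1)]) (assumption, blast intro: that)
  have decay: "eventually (\<lambda>n. exp (- \<eta> * real n) * real (n + 1) ^ CARD('s \<times> 's) \<le> t / 2) sequentially"
  proof -
    have "eventually (\<lambda>n. exp (- \<eta> * real n) * real (n + 1) ^ CARD('s \<times> 's) < t / 2) sequentially"
      by (rule order_tendstoD(2)[OF exp_decay_poly[OF \<eta>(1)]]) (use \<open>t > 0\<close> in simp)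
    then show ?thesis by (rule eventually_mono) simp
  qed
  show ?thesis
  proof (rule that[OF \<eta>(2)])
    fix \<kappa>' assume "\<kappa>' \<le> \<kappa>"
    from near decay eventually_gt_at_top[of 0]
    show "eventually (\<lambda>n. \<forall>j. label_avg2 n \<pi> (\<lambda>\<sigma> \<tau>. of_bool (balanced \<kappa>' n \<pi> \<sigma> \<and> balanced \<kappa>' n \<pi> \<tau>) *
      (exp (real n * kron_form B (emp n \<sigma> \<tau>)) *
       ((\<Sum>v\<in>{1..n}. centred \<pi> j (\<sigma> v) * centred \<pi> j (\<tau> v)) / real n)\<^sup>2)) \<le> t) sequentially"
    proof eventually_elim
      case (elim n)
      show ?case
      proof
        fix j
        let ?e = "\<lambda>\<sigma> \<tau>. exp (real n * kron_form B (emp n \<sigma> \<tau> - ?p))"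
        let ?near = "\<lambda>\<sigma> \<tau>. if norm (emp n \<sigma> \<tau> - ?p) < \<epsilon>0 then ?e \<sigma> \<tau> else 0"
        let ?away = "\<lambda>\<sigma> \<tau>. if balanced \<kappa> n \<pi> \<sigma> \<and> balanced \<kappa> n \<pi> \<tau> \<and> norm (emp n \<sigma> \<tau> - ?p) \<ge> \<epsilon>
            then ?e \<sigma> \<tau> else 0"
        let ?h = "\<lambda>\<sigma> \<tau>. (\<Sum>v\<in>{1..n}. centred \<pi> j (\<sigma> v) * centred \<pi> j (\<tau> v)) / real n"
        let ?F = "\<lambda>\<sigma> \<tau>. of_bool (balanced \<kappa>' n \<pi> \<sigma> \<and> balanced \<kappa>' n \<pi> \<tau>) *
            (exp (real n * kron_form B (emp n \<sigma> \<tau>)) * (?h \<sigma> \<tau>)\<^sup>2)"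
        have "label_avg2 n \<pi> ?F \<le> label_avg2 n \<pi> (\<lambda>\<sigma> \<tau>. b * ?near \<sigma> \<tau> + ?away \<sigma> \<tau>)"
        proof (rule label_avg2_mono)
          fix \<sigma> \<tau> :: "'s labelling"
          have nn: "0 \<le> b * ?near \<sigma> \<tau>" "0 \<le> ?away \<sigma> \<tau>" using b by auto
          show "?F \<sigma> \<tau> \<le> b * ?near \<sigma> \<tau> + ?away \<sigma> \<tau>"
          proof (cases "balanced \<kappa>' n \<pi> \<sigma> \<and> balanced \<kappa>' n \<pi> \<tau>")
            case False
            then have "?F \<sigma> \<tau> = 0" by simp
            then show ?thesis using nn by linarith
          next
            case True
            then have bal: "balanced \<kappa> n \<pi> \<sigma>" "balanced \<kappa> n \<pi> \<tau>"
              using balanced_mono \<open>\<kappa>' \<le> \<kappa>\<close> by blast+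
            have F: "?F \<sigma> \<tau> = (?h \<sigma> \<tau>)\<^sup>2 * ?e \<sigma> \<tau>"
              using True by (simp add: kron_form_minus_product_coupling[OF B])
            show ?thesis
            proof (cases "norm (emp n \<sigma> \<tau> - ?p) < \<epsilon>")
              case True
              have "\<bar>?h \<sigma> \<tau>\<bar> \<le> ?N * norm (emp n \<sigma> \<tau> - ?p)" by (rule centred_overlap) fact
              also have "\<dots> \<le> ?N * \<epsilon>" using True by (intro mult_left_mono) auto
              also note N\<epsilon>
              finally have "(?h \<sigma> \<tau>)\<^sup>2 \<le> (sqrt b)\<^sup>2"
                using b by (intro abs_le_square_iff[THEN iffD1]) simp
              then have "(?h \<sigma> \<tau>)\<^sup>2 * ?e \<sigma> \<tau> \<le> b * ?e \<sigma> \<tau>"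
                using b by (intro mult_right_mono) auto
              moreover have "b * ?near \<sigma> \<tau> = b * ?e \<sigma> \<tau>" using True \<epsilon>(2) by simp
              ultimately show ?thesis using nn(2) unfolding F by linarith
            next
              case False
              have "(?h \<sigma> \<tau>)\<^sup>2 \<le> 1"
                using centred_overlap(2)[OF elim(3), of \<pi> j \<sigma> \<tau>] by (simp add: abs_square_le_1)
              then have "(?h \<sigma> \<tau>)\<^sup>2 * ?e \<sigma> \<tau> \<le> 1 * ?e \<sigma> \<tau>" by (intro mult_right_mono) auto
              moreover have "?away \<sigma> \<tau> = ?e \<sigma> \<tau>" using False bal by simp
              ultimately show ?thesis using nn(1) unfolding F by linarith
            qed
          qed
        qed
        also have "\<dots> = b * label_avg2 n \<pi> ?near + label_avg2 n \<pi> ?away"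
          by (simp only: label_avg_add label_avg_cmult)
        also have "\<dots> \<le> b * (\<bar>C\<bar> + 1) + t / 2"
          using elim away[OF elim(3)] b by (intro add_mono mult_left_mono) auto
        also have "b * (\<bar>C\<bar> + 1) = t / 2" unfolding b_def by (simp add: field_simps)
        finally show "label_avg2 n \<pi> ?F \<le> t" by simp
      qed
    qed
  qed
qed

section \<open>Impossibility of reconstruction\<close>

theorem theorem3p9:
  fixes M :: "real ^ 's::finite ^ 's" and \<pi> :: "'s pmf" and d :: real
  assumes "CARD('s) \<ge> 2"
    and "transpose M = M"
    and "\<And>i j. M $ i $ j \<ge> 0"
    and "\<And>i. (\<Sum>j\<in>UNIV. M $ i $ j * pmf \<pi> j) = d"
    and "d > 0"
    and "Q \<pi> ((M - (\<chi> i j. d)) /\<^sub>R sqrt (2 * d)) < 1"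
  shows "\<not> reconstructable M \<pi>"
proof
  define B where "B = (M - (\<chi> i j. d)) /\<^sub>R sqrt (2 * d)"
  obtain c where c: "0 \<le> c" "c < 1" "\<And>\<alpha>. \<alpha> \<in> couplings \<pi> \<Longrightarrow>
       kron_form B (\<alpha> - product_coupling \<pi>) \<le> c * KL_div \<alpha> (product_coupling \<pi>)"
    using Q_less_one_imp assms(6) unfolding B_def by metis
  have symM: "M $ i $ j = M $ j $ i" for i j
    using assms(2) by (metis transpose_def vec_lambda_beta)
  have B: "transpose B = B" "\<And>i. (\<Sum>j\<in>UNIV. B $ i $ j * pmf \<pi> j) = 0"
  proof -
    show "transpose B = B" by (simp add: B_def transpose_def vec_eq_iff symM)
    fix i
    have "(\<Sum>j\<in>UNIV. B $ i $ j * pmf \<pi> j) = (\<Sum>j\<in>UNIV. M $ i $ j * pmf \<pi> j - d * pmf \<pi> j) / sqrt (2 * d)"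
      unfolding sum_divide_distrib by (intro sum.cong refl) (simp add: B_def divide_inverse algebra_simps)
    then show "(\<Sum>j\<in>UNIV. B $ i $ j * pmf \<pi> j) = 0"
      by (simp add: sum_subtractf assms(4) sum_distrib_left[symmetric] sum_pmf_eq_1)
  qed
  obtain C where C: "C > 0" "eventually (\<lambda>n. n > 0 \<and> d / real n < 1 \<and> (\<forall>\<sigma> \<tau>.
     (\<Sum>X\<in>edge_sets n. edge_pmf n (sbm_edge_prob n M \<sigma>) X * edge_pmf n (sbm_edge_prob n M \<tau>) X
        / edge_pmf n (\<lambda>_. d / real n) X) \<le> C * exp (real n * kron_form B (emp n \<sigma> \<tau>)))) sequentially"
    using sbm_kernel_le[OF assms(2,3,5) B_def] by blast
  assume "reconstructable M \<pi>"
  then obtain \<delta> L and \<A> :: "graph \<Rightarrow> 's labelling" where \<delta>: "\<delta> > 0" and L: "L > 0"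
    and lim: "(\<lambda>n. measure_pmf.prob (sbm n M \<pi>) {(G, \<sigma>). overlap n (\<A> G) \<sigma> > \<delta>}) \<longlonglongrightarrow> L"
    unfolding reconstructable_def by blast
  define D where "D = \<delta> / (2 * real CARD('s))"
  have D: "D > 0" using \<delta> by (simp add: D_def)
  \<comment> \<open>With this value, the \<open>(CARD('s))\<^sup>2\<close> label pairs, each
    weighted by \<open>1 / D\<^sup>2\<close>, contribute \<open>L / 4\<close> in total.\<close>
  define e where "e = L / (4 * (real CARD('s))\<^sup>2 / D\<^sup>2)"
  have e: "e > 0" using L D by (simp add: e_def)
  obtain \<kappa>0 where \<kappa>0: "\<kappa>0 > 0" "\<And>\<kappa>'. \<kappa>' \<le> \<kappa>0 \<Longrightarrow> eventually (\<lambda>n. \<forall>j.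
    label_avg2 n \<pi> (\<lambda>\<sigma> \<tau>. of_bool (balanced \<kappa>' n \<pi> \<sigma> \<and> balanced \<kappa>' n \<pi> \<tau>) *
      (exp (real n * kron_form B (emp n \<sigma> \<tau>)) *
       ((\<Sum>v\<in>{1..n}. centred \<pi> j (\<sigma> v) * centred \<pi> j (\<tau> v)) / real n)\<^sup>2)) \<le> e\<^sup>2 / C) sequentially"
    using weighted_overlap_small[OF c B, of "e\<^sup>2 / C"] e C(1) by auto
  \<comment> \<open>The three bounds are required by the weighted second moment, the concentration
    estimate and the extraction of a label pair from a large overlap.\<close>
  define \<kappa> where "\<kappa> = min \<kappa>0 (min 1 D)"
  have \<kappa>: "0 < \<kappa>" "\<kappa> \<le> 1" "\<kappa> \<le> D" "\<kappa> \<le> \<kappa>0" using \<kappa>0(1) D by (auto simp: \<kappa>_def)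
  have "((\<lambda>n. 2 * real CARD('s) * exp (- (\<kappa>\<^sup>2 / 4) * real n)) \<longlonglongrightarrow> 0)"
    using \<kappa>(1) by real_asymp
  then have decay: "eventually (\<lambda>n. 2 * real CARD('s) * exp (- (\<kappa>\<^sup>2 / 4) * real n) < L / 4) sequentially"
    by (rule order_tendstoD(2)) (use L in simp)
  \<comment> \<open>A bound by half of the supposed limit suffices for a contradiction.\<close>
  have "eventually (\<lambda>n. measure_pmf.prob (sbm n M \<pi>) {(G, \<sigma>). overlap n (\<A> G) \<sigma> > \<delta>} \<le> L / 2) sequentially"
    using C(2) \<kappa>0(2)[OF \<kappa>(4)] decay
  proof eventually_elim
    case (elim n)
    then have n: "n > 0" and q: "0 < d / real n" "d / real n < 1" using assms(5) by auto
    define T where "T X = \<A> ({1..n}, {{u, v} | u v. X (u, v)})" for X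
    define P where "P \<sigma> = edge_pmf n (sbm_edge_prob n M \<sigma>)" for \<sigma>
    have P: "P \<sigma> X \<ge> 0" "(\<Sum>X\<in>edge_sets n. P \<sigma> X) = 1" for \<sigma> X
      by (simp_all add: P_def edge_pmf_nonneg sum_edge_pmf)
    let ?g = "\<lambda>i j \<sigma> X. of_bool (balanced \<kappa> n \<pi> \<sigma>) *
        ((\<Sum>v\<in>{1..n}. of_bool (T X v = i) * centred \<pi> j (\<sigma> v)) / real n)\<^sup>2"
    \<comment> \<open>Markov's inequality for squares, summed over all label pairs since the pair
      may depend on \<open>\<sigma>\<close> and \<open>X\<close>.\<close>
    have pointwise: "of_bool (overlap n (T X) \<sigma> > \<delta>)
        \<le> of_bool (\<not> balanced \<kappa> n \<pi> \<sigma>) + (\<Sum>i\<in>UNIV. \<Sum>j\<in>UNIV. 1 / D\<^sup>2 * ?g i j \<sigma> X)" for \<sigma> X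
    proof (cases "overlap n (T X) \<sigma> > \<delta> \<and> balanced \<kappa> n \<pi> \<sigma>")
      case False
      have "0 \<le> (\<Sum>i\<in>UNIV. \<Sum>j\<in>UNIV. 1 / D\<^sup>2 * ?g i j \<sigma> X)" by (intro sum_nonneg) auto
      with False show ?thesis by (auto simp: of_bool_def)
    next
      case True
      then obtain i j where "(\<Sum>v\<in>{1..n}. of_bool (T X v = i) * centred \<pi> j (\<sigma> v)) / real n > D"
        using overlap_large_imp[of \<delta> n "T X" \<sigma> \<kappa> \<pi>] \<kappa>(3) n unfolding D_def by blast
      then have "D\<^sup>2 \<le> ?g i j \<sigma> X" using True D by (simp add: power_mono)
      then have "1 / D\<^sup>2 * D\<^sup>2 \<le> 1 / D\<^sup>2 * ?g i j \<sigma> X" by (rule mult_left_mono) simp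
      then have "1 \<le> 1 / D\<^sup>2 * ?g i j \<sigma> X" using D by simp
      also have "\<dots> \<le> (\<Sum>j\<in>UNIV. 1 / D\<^sup>2 * ?g i j \<sigma> X)"
        by (intro member_le_sum[of j UNIV "\<lambda>j. 1 / D\<^sup>2 * ?g i j \<sigma> X"]) auto
      also have "\<dots> \<le> (\<Sum>i\<in>UNIV. \<Sum>j\<in>UNIV. 1 / D\<^sup>2 * ?g i j \<sigma> X)"
        by (intro member_le_sum[of i UNIV "\<lambda>i. \<Sum>j\<in>UNIV. 1 / D\<^sup>2 * ?g i j \<sigma> X"] sum_nonneg) auto
      finally show ?thesis using True by simp
    qed
    have small: "label_avg n \<pi> (\<lambda>\<sigma>. \<Sum>X\<in>edge_sets n. P \<sigma> X * ?g i j \<sigma> X) \<le> e" for i j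
    proof (rule power2_le_imp_le)
      let ?h = "\<lambda>\<sigma> \<tau>. ((\<Sum>v\<in>{1..n}. centred \<pi> j (\<sigma> v) * centred \<pi> j (\<tau> v)) / real n)\<^sup>2"
      let ?b = "\<lambda>\<sigma> \<tau>. of_bool (balanced \<kappa> n \<pi> \<sigma> \<and> balanced \<kappa> n \<pi> \<tau>) :: real"
      have "(label_avg n \<pi> (\<lambda>\<sigma>. \<Sum>X\<in>edge_sets n. P \<sigma> X * ?g i j \<sigma> X))\<^sup>2
        \<le> label_avg2 n \<pi> (\<lambda>\<sigma> \<tau>. ?b \<sigma> \<tau> *
          ((\<Sum>X\<in>edge_sets n. P \<sigma> X * P \<tau> X / edge_pmf n (\<lambda>_. d / real n) X) * ?h \<sigma> \<tau>))"
        unfolding P_def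
        by (rule posterior_square_le[OF q _ n, where x = "\<lambda>v X. of_bool (T X v = i)"]) simp
      \<comment> \<open>The algorithm has disappeared; the constant \<open>C\<close> of the kernel
        bound cancels against the target \<open>e\<^sup>2 / C\<close> used for
        \<open>\<kappa>0\<close>.\<close>
      also have "\<dots> \<le> label_avg2 n \<pi> (\<lambda>\<sigma> \<tau>. ?b \<sigma> \<tau> *
          ((C * exp (real n * kron_form B (emp n \<sigma> \<tau>))) * ?h \<sigma> \<tau>))"
        using elim(1) unfolding P_def by (intro label_avg2_mono mult_left_mono mult_right_mono) auto
      also have "\<dots> = C * label_avg2 n \<pi> (\<lambda>\<sigma> \<tau>. ?b \<sigma> \<tau> *
          (exp (real n * kron_form B (emp n \<sigma> \<tau>)) * ?h \<sigma> \<tau>))"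
        by (simp add: label_avg2_cmult[symmetric] mult_ac)
      also have "\<dots> \<le> C * (e\<^sup>2 / C)"
        using elim(2) C(1) by (intro mult_left_mono) auto
      also have "\<dots> = e\<^sup>2" using C(1) by simp
      finally show "(label_avg n \<pi> (\<lambda>\<sigma>. \<Sum>X\<in>edge_sets n. P \<sigma> X * ?g i j \<sigma> X))\<^sup>2 \<le> e\<^sup>2" .
    qed (use e in simp)
    have "measure_pmf.prob (sbm n M \<pi>) {(G, \<sigma>). overlap n (\<A> G) \<sigma> > \<delta>}
        = label_avg n \<pi> (\<lambda>\<sigma>. \<Sum>X\<in>edge_sets n. P \<sigma> X * of_bool (overlap n (T X) \<sigma> > \<delta>))"
      unfolding prob_sbm P_def T_def ..
    also have "\<dots> \<le> label_avg n \<pi> (\<lambda>\<sigma>. \<Sum>X\<in>edge_sets n. P \<sigma> X *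
        (of_bool (\<not> balanced \<kappa> n \<pi> \<sigma>) + (\<Sum>i\<in>UNIV. \<Sum>j\<in>UNIV. 1 / D\<^sup>2 * ?g i j \<sigma> X)))"
      by (intro label_avg_mono sum_mono mult_left_mono pointwise P)
    also have "\<dots> = label_avg n \<pi> (\<lambda>\<sigma>. of_bool (\<not> balanced \<kappa> n \<pi> \<sigma>) +
        (\<Sum>i\<in>UNIV. \<Sum>j\<in>UNIV. 1 / D\<^sup>2 * (\<Sum>X\<in>edge_sets n. P \<sigma> X * ?g i j \<sigma> X)))"
    proof (intro arg_cong[where f = "label_avg n \<pi>"] ext)
      fix \<sigma>
      let ?G = "\<lambda>i j X. 1 / D\<^sup>2 * (P \<sigma> X * ?g i j \<sigma> X)"
      have "(\<Sum>X\<in>edge_sets n. P \<sigma> X *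
        (of_bool (\<not> balanced \<kappa> n \<pi> \<sigma>) + (\<Sum>i\<in>UNIV. \<Sum>j\<in>UNIV. 1 / D\<^sup>2 * ?g i j \<sigma> X)))
        = of_bool (\<not> balanced \<kappa> n \<pi> \<sigma>) * (\<Sum>X\<in>edge_sets n. P \<sigma> X) + (\<Sum>X\<in>edge_sets n. \<Sum>i\<in>UNIV. \<Sum>j\<in>UNIV. ?G i j X)"
        unfolding distrib_left sum.distrib sum_distrib_left by (simp add: mult_ac)
      also have "(\<Sum>X\<in>edge_sets n. \<Sum>i\<in>UNIV. \<Sum>j\<in>UNIV. ?G i j X) = (\<Sum>i\<in>UNIV. \<Sum>j\<in>UNIV. \<Sum>X\<in>edge_sets n. ?G i j X)"
        by (rule sum_swap_inner2)
      finally show "(\<Sum>X\<in>edge_sets n. P \<sigma> X *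
        (of_bool (\<not> balanced \<kappa> n \<pi> \<sigma>) + (\<Sum>i\<in>UNIV. \<Sum>j\<in>UNIV. 1 / D\<^sup>2 * ?g i j \<sigma> X)))
        = of_bool (\<not> balanced \<kappa> n \<pi> \<sigma>) + (\<Sum>i\<in>UNIV. \<Sum>j\<in>UNIV. 1 / D\<^sup>2 * (\<Sum>X\<in>edge_sets n. P \<sigma> X * ?g i j \<sigma> X))"
        unfolding P(2) sum_distrib_left by simp
    qed
    also have "\<dots> = label_avg n \<pi> (\<lambda>\<sigma>. of_bool (\<not> balanced \<kappa> n \<pi> \<sigma>)) +
        (\<Sum>i\<in>UNIV. \<Sum>j\<in>UNIV. 1 / D\<^sup>2 * label_avg n \<pi> (\<lambda>\<sigma>. \<Sum>X\<in>edge_sets n. P \<sigma> X * ?g i j \<sigma> X))"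
      by (simp only: label_avg_add label_avg_sum[of n \<pi> _ UNIV] label_avg_cmult)
    also have "\<dots> \<le> L / 4 + (\<Sum>i\<in>(UNIV::'s set). \<Sum>j\<in>(UNIV::'s set). 1 / D\<^sup>2 * e)"
      using label_avg_not_balanced[OF \<kappa>(1,2) n, of \<pi>] elim(3)
      by (intro add_mono sum_mono mult_left_mono small) auto
    also have "(\<Sum>i\<in>(UNIV::'s set). \<Sum>j\<in>(UNIV::'s set). 1 / D\<^sup>2 * e) = L / 4"
      using D by (simp add: e_def power2_eq_square field_simps)
    finally show ?case by simp
  qed
  then have "L \<le> L / 2" using lim by (intro tendsto_upperbound) auto
  then show False using L by simp
qed

end
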